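(* Let $a,b,c$ be pairwise distinct positive real numbers, and let $G_1$ and $G_2$ be the metric graphs described in the context, each equipped with the Laplacian $\Delta$ under Dirichlet standard boundary conditions. Then: (i) $G_1$ and $G_2$ are isospectral, i.e. $-\Delta$ has the same eigenvalues, counted with multiplicity, on $G_1$ and on $G_2$; (ii) $G_1$ and $G_2$ are not isometric; (iii) $T(G_1)\neq T(G_2)$, where $T$ denotes torsional rigidity.
   Context: A compact metric graph is a finite connected graph without loops in which each edge $e$ is identified with an interval $[0,l_e]$, $l_e>0$, with coordinate $x_e$. A function $\phi$ on the graph is a collection $\phi=\oplus_e \phi_e$ of functions on the edges. The Laplacian $\Delta$ acts as $(\Delta\phi)_e=\phi_e''$ on each edge. Dirichlet standard boundary conditions (DSBC) require that $\phi_e,\phi_e'$ be absolutely continuous with $\phi_e''\in L^2$ on every edge, together with the following vertex conditions: - $\phi$ is continuous at every vertex of degree $\geq 2$; - $\phi(v)=0$ at every vertex $v$ of degree $1$; - at every vertex $v$ of degree $\ne 1$, the sum over the edges incident to $v$ of the derivatives of $\phi$ taken in the direction pointing into $v$ is $0$ (Kirchhoff condition). With DSBC, $\Delta$ is self-adjoint with discrete spectrum. The torsional rigidity of such a graph $G$ is $T(G)=\int_G u(x)\,dx$, where $u$ is the unique function satisfying DSBC with $u_e''=-1$ on every edge. The graph $G_1$ has 16 vertices: - a central vertex $o$; - three vertices $m_1,m_2,m_3$; - three vertices $w_1,w_2,w_3$; - nine vertices of degree one. The edges of $G_1$ are: - $o m_1$ of length $2c$, $o m_2$ of length $2a$, $o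 m_3$ of length $2b$; - $m_1 w_1$ of length $2b$, $m_2 w_2$ of length $2c$, $m_3 w_3$ of length $2a$; - a pendant edge (ending at a degree-one vertex) at $m_1$ of length $a$, at $m_2$ of length $b$, and at $m_3$ of length $c$; - two pendant edges at $w_1$ of lengths $a$ and $c$, two at $w_2$ of lengths $a$ and $b$, and two at $w_3$ of lengths $b$ and $c$. The graph $G_2$ is obtained from $G_1$ by interchanging the roles of $b$ and $c$. Explicitly, its edges are: - $o m_1$ of length $2b$, $o m_2$ of length $2a$, $o m_3$ of length $2c$; - $m_1w_1$ of length $2c$, $m_2w_2$ of length $2b$, $m_3w_3$ of length $2a$; - a pendant edge at $m_1$ of length $a$, at $m_2$ of length $c$, and at $m_3$ of length $b$; - two pendant edges at $w_1$ of lengths $a,b$, at $w_2$ of lengths $a,c$, and at $w_3$ of lengths $c,b$. (These are the quantum graph analogs, with degree-two vertices removed, of the $7_1$ pair of isospectral planar domains of Buser–Conway–Doyle–Semmler.) *)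

theory Defs
  imports "HOL-Analysis.Analysis"
begin

text \<open>A metric graph is a list of edges (u, v, l): the edge joins vertex u (coordinate x = 0)
  to vertex v (coordinate x = l), and has length l. Edges are indexed by their position in the
  list. Functions on the graph are families phi :: nat => real => real, phi i being the function on
  edge i, considered on the interval [0, len G i].\<close>

type_synonym mgraph = "(nat \<times> nat \<times> real) list"

definition src :: "mgraph \<Rightarrow> nat \<Rightarrow> nat" where "src G i = fst (G ! i)"
definition tgt :: "mgraph \<Rightarrow> nat \<Rightarrow> nat" where "tgt G i = fst (snd (G ! i))"
definition len :: "mgraph \<Rightarrow> nat \<Rightarrow> real" where "len G i = snd (snd (G ! i))"

definition edges :: "mgraph \<Rightarrow> nat set" where "edges G = {..<length G}"

definition incident :: "mgraph \<Rightarrow> nat \<Rightarrow> nat \<Rightarrow> bool" where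
  "incident G v i \<longleftrightarrow> i \<in> edges G \<and> (src G i = v \<or> tgt G i = v)"

definition deg :: "mgraph \<Rightarrow> nat \<Rightarrow> nat" where
  "deg G v = card {i \<in> edges G. src G i = v} + card {i \<in> edges G. tgt G i = v}"

text \<open>Value of phi at the endpoint v of edge i (graphs have no loops).\<close>
definition val_at :: "mgraph \<Rightarrow> (nat \<Rightarrow> real \<Rightarrow> real) \<Rightarrow> nat \<Rightarrow> nat \<Rightarrow> real" where
  "val_at G phi i v = (if src G i = v then phi i 0 else phi i (len G i))"

text \<open>H^2 regularity on [0,l]: f and its derivative f1 are absolutely continuous (integral
  representations), the second derivative f2 is in L^2(0,l).\<close>
definition H2_edge :: "real \<Rightarrow> (real \<Rightarrow> real) \<Rightarrow> (real \<Rightarrow> real) \<Rightarrow> (real \<Rightarrow> real) \<Rightarrow> bool" where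
  "H2_edge l f f1 f2 \<longleftrightarrow>
     f2 absolutely_integrable_on {0..l} \<and> (\<lambda>x. (f2 x)^2) integrable_on {0..l} \<and>
     (\<forall>x\<in>{0..l}. f1 x = f1 0 + integral {0..x} f2 \<and> f x = f 0 + integral {0..x} f1)"

definition DSBC :: "mgraph \<Rightarrow> (nat \<Rightarrow> real \<Rightarrow> real) \<Rightarrow> (nat \<Rightarrow> real \<Rightarrow> real)
                     \<Rightarrow> (nat \<Rightarrow> real \<Rightarrow> real) \<Rightarrow> bool" where
  "DSBC G phi phi1 phi2 \<longleftrightarrow>
     (\<forall>i\<in>edges G. H2_edge (len G i) (phi i) (phi1 i) (phi2 i)) \<and>
     (\<forall>v. deg G v \<ge> 2 \<longrightarrow> (\<forall>i j. incident G v i \<and> incident G v j \<longrightarrow>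
                                      val_at G phi i v = val_at G phi j v)) \<and>
     (\<forall>v. deg G v = 1 \<longrightarrow> (\<forall>i. incident G v i \<longrightarrow> val_at G phi i v = 0)) \<and>
     (\<forall>v. deg G v \<noteq> 1 \<longrightarrow>
          (\<Sum>i\<in>{i \<in> edges G. src G i = v}. - phi1 i 0)
        + (\<Sum>i\<in>{i \<in> edges G. tgt G i = v}. phi1 i (len G i)) = 0)"

definition normalised :: "mgraph \<Rightarrow> (nat \<Rightarrow> real \<Rightarrow> real) \<Rightarrow> bool" where
  "normalised G phi \<longleftrightarrow> (\<forall>i x. (i \<notin> edges G \<or> x \<notin> {0..len G i}) \<longrightarrow> phi i x = 0)"

definition eigenspace :: "mgraph \<Rightarrow> real \<Rightarrow> (nat \<Rightarrow> real \<Rightarrow> real) set" where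
  "eigenspace G lam = {phi. normalised G phi \<and>
     (\<exists>phi1 phi2. DSBC G phi phi1 phi2 \<and>
        (\<forall>i\<in>edges G. negligible {x \<in> {0..len G i}. phi2 i x \<noteq> - lam * phi i x}))}"

definition lin_indep :: "(nat \<Rightarrow> real \<Rightarrow> real) list \<Rightarrow> bool" where
  "lin_indep fs \<longleftrightarrow> (\<forall>c :: nat \<Rightarrow> real.
      (\<lambda>i x. \<Sum>k<length fs. c k * (fs ! k) i x) = (\<lambda>i x. 0) \<longrightarrow> (\<forall>k<length fs. c k = 0))"

definition multiplicity :: "mgraph \<Rightarrow> real \<Rightarrow> enat" where
  "multiplicity G lam = Sup {enat (length fs) | fs. set fs \<subseteq> eigenspace G lam \<and> lin_indep fs}"

definition isospectral :: "mgraph \<Rightarrow> mgraph \<Rightarrow> bool" where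
  "isospectral G H \<longleftrightarrow> (\<forall>lam. multiplicity G lam = multiplicity H lam)"

definition torsion :: "mgraph \<Rightarrow> real" where
  "torsion G = (THE t. \<exists>u u1 u2. DSBC G u u1 u2 \<and>
      (\<forall>i\<in>edges G. negligible {x \<in> {0..len G i}. u2 i x \<noteq> -1}) \<and>
      t = (\<Sum>i\<in>edges G. integral {0..len G i} (u i)))"

fun is_walk :: "mgraph \<Rightarrow> nat \<Rightarrow> nat \<Rightarrow> nat list \<Rightarrow> bool" where
  "is_walk G u v [] = (u = v)"
| "is_walk G u v (i # is) = (i \<in> edges G \<and>
      ((src G i = u \<and> is_walk G (tgt G i) v is) \<or> (tgt G i = u \<and> is_walk G (src G i) v is)))"

definition vdist :: "mgraph \<Rightarrow> nat \<Rightarrow> nat \<Rightarrow> real" where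
  "vdist G u v = Inf {sum_list (map (len G) ws) | ws. is_walk G u v ws}"

definition points :: "mgraph \<Rightarrow> (nat \<times> real) set" where
  "points G = {(i, x). i \<in> edges G \<and> 0 \<le> x \<and> x \<le> len G i}"

definition ends :: "mgraph \<Rightarrow> nat \<Rightarrow> real \<Rightarrow> (nat \<times> real) set" where
  "ends G i x = {(src G i, x), (tgt G i, len G i - x)}"

text \<open>Shortest-path (pseudo)distance between points; points representing the same vertex
  have distance 0.\<close>
definition pdist :: "mgraph \<Rightarrow> nat \<times> real \<Rightarrow> nat \<times> real \<Rightarrow> real" where
  "pdist G p q = (case (p, q) of ((i, x), (j, y)) \<Rightarrow>
     Inf ({\<bar>x - y\<bar> | _::unit. i = j} \<union>
          {dA + vdist G a b + dB | a b dA dB. (a, dA) \<in> ends G i x \<and> (b, dB) \<in> ends G j y}))"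

text \<open>Isometry of metric spaces (onto, up to identification of points at distance 0).\<close>
definition isometric :: "mgraph \<Rightarrow> mgraph \<Rightarrow> bool" where
  "isometric G H \<longleftrightarrow> (\<exists>f. (\<forall>p\<in>points G. f p \<in> points H) \<and>
     (\<forall>p\<in>points G. \<forall>q\<in>points G. pdist H (f p) (f q) = pdist G p q) \<and>
     (\<forall>q\<in>points H. \<exists>p\<in>points G. pdist H (f p) q = 0))"

text \<open>Vertex numbering: o = 0; m1, m2, m3 = 1, 2, 3; w1, w2, w3 = 4, 5, 6;
  the nine degree-one vertices are 7, ..., 15.\<close>

definition G1 :: "real \<Rightarrow> real \<Rightarrow> real \<Rightarrow> mgraph" where
  "G1 a b c = [(0, 1, 2*c), (0, 2, 2*a), (0, 3, 2*b),
               (1, 4, 2*b), (2, 5, 2*c), (3, 6, 2*a),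
               (1, 7, a), (2, 8, b), (3, 9, c),
               (4, 10, a), (4, 11, c), (5, 12, a), (5, 13, b), (6, 14, b), (6, 15, c)]"

definition G2 :: "real \<Rightarrow> real \<Rightarrow> real \<Rightarrow> mgraph" where
  "G2 a b c = [(0, 1, 2*b), (0, 2, 2*a), (0, 3, 2*c),
               (1, 4, 2*c), (2, 5, 2*b), (3, 6, 2*a),
               (1, 7, a), (2, 8, c), (3, 9, b),
               (4, 10, a), (4, 11, b), (5, 12, a), (5, 13, c), (6, 14, c), (6, 15, b)]"

end

theory Submission
  imports Defs
begin

text \<open>\<open>G2\<close> is \<open>G1\<close> with \<open>b\<close> and \<open>c\<close> exchanged. Isospectrality is Sunada--Buser transplantation: both graphs
  consist of seven tripods, and a fixed invertible matrix intertwining the gluings carries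
  eigenfunctions of one graph to eigenfunctions of the other. For the torsion, the
  vertex values solve a linear system whose solution is an explicit rational function, and
  \<open>T(G\<^sub>1) - T(G\<^sub>2)\<close> is \<open>(a - b) (b - c) (c - a)\<close> times a quotient of polynomials with positive coefficients.
  An isometry preserves the set of degree-one vertices, which are the points not strictly between two
  others, hence also the sum of the cubes of their mutual distances; these sums
  differ by \<open>24 (a - b) (b - c) (c - a)\<close>.\<close>

section \<open>Functions on an edge\<close>

text \<open>Exchanging \<open>b\<close> and \<open>c\<close> turns each graph into the other, so one
  map that preserves linear independence, valid for all lengths, bounds the multiplicities in both
  directions. Such a map exists because the gluing and Dirichlet conditions involve the lengths and
  the eigenvalue only through scalar coefficients attached to a leg; a matrix acting on the index of
  the tripods passes through these. The torsion function is not carried along: the matrix turns the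
  second derivative -1 into minus its row sums 3, 1, 1, 1, -1, -1, -1. This leaves room for the
  rigidities to differ, and they have to be computed. An isometry is a mere map of points that knows
  nothing of edges. Degree one therefore has to be expressed by distances, and the distances,
  defined as infima over walks, have to be made computable.\<close>

lemma ex_fundamental_solutions:
  fixes lam :: real
  obtains C S :: "real \<Rightarrow> real"
  where "\<And>x. (C has_real_derivative - lam * S x) (at x)"
    and "\<And>x. (S has_real_derivative C x) (at x)"
    and "C 0 = 1" and "S 0 = 0"
proof -
  consider "lam = 0" | "lam > 0" | "lam < 0" by linarith
  then show ?thesis
  proof cases
    case 1
    show ?thesis
      by (rule that[of "\<lambda>_. 1" "\<lambda>x. x"]) (auto simp: 1 intro!: derivative_eq_intros)
  next
    case 2
    define w where "w = sqrt lam"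
    have w: "w > 0" "w * w = lam" using 2 by (auto simp: w_def)
    show ?thesis
      by (rule that[of "\<lambda>x. cos (w * x)" "\<lambda>x. sin (w * x) / w"])
        (use w in \<open>auto intro!: derivative_eq_intros simp: field_simps\<close>)
  next
    case 3
    define w where "w = sqrt (- lam)"
    have w: "w > 0" "lam = - (w * w)" using 3 by (auto simp: w_def)
    show ?thesis
      by (rule that[of "\<lambda>x. cosh (w * x)" "\<lambda>x. sinh (w * x) / w"])
        (use w in \<open>auto intro!: derivative_eq_intros simp: field_simps\<close>)
  qed
qed

text \<open>Isospectrality quantifies over every real \<open>lam\<close>, so its sign is unknown.
  \<open>C\<close> and \<open>S\<close> stand for cosine and sine, for 1 and x, or for their
  hyperbolic analogues; since \<open>S\<close> has slope 1 at 0, the coefficients of a solution are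
  its value and slope at 0 in all three cases.\<close>

locale fundamental_solutions =
  fixes lam :: real and C S :: "real \<Rightarrow> real"
  assumes DC: "\<And>x. (C has_real_derivative - lam * S x) (at x)"
    and DS: "\<And>x. (S has_real_derivative C x) (at x)"
    and C0: "C 0 = 1" and S0: "S 0 = 0"
begin

lemma DC_within: "(C has_real_derivative - lam * S x) (at x within A)"
  using DC has_field_derivative_at_within by blast

lemma DS_within: "(S has_real_derivative C x) (at x within A)"
  using DS has_field_derivative_at_within by blast

text \<open>The left side is the determinant of the transfer matrix that takes value and slope at 0
  to value and slope at \<open>x\<close>.\<close>

lemma energy: "C x * C x + lam * (S x * S x) = 1"
proof -
  have "((\<lambda>x. C x * C x + lam * (S x * S x)) has_real_derivative 0) (at t)" for t
    by (rule derivative_eq_intros DC DS refl)+ (simp add: algebra_simps)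
  from DERIV_const_ratio_const[OF _ this, of 0 x] show ?thesis
    by (cases "x = 0") (auto simp: C0 S0)
qed

lemma solution_unique:
  assumes f: "\<And>t. t \<in> {0..l} \<Longrightarrow> (f has_real_derivative g t) (at t within {0..l})"
    and g: "\<And>t. t \<in> {0..l} \<Longrightarrow> (g has_real_derivative - lam * f t) (at t within {0..l})"
    and x: "x \<in> {0..l}"
  shows "f x = f 0 * C x + g 0 * S x" and "g x = - lam * f 0 * S x + g 0 * C x"
proof -
  have 0: "0 \<in> {0..l}" using x by auto
  \<comment> \<open>\<open>p\<close> and \<open>q\<close> apply the inverse transfer matrix to value
    and slope at \<open>t\<close>; being constant, they equal the initial data.\<close>
  define p where "p = (\<lambda>t. f t * C t - g t * S t)"
  define q where "q = (\<lambda>t. lam * (f t * S t) + g t * C t)"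
  have "(p has_real_derivative 0) (at t within {0..l})" if "t \<in> {0..l}" for t
    unfolding p_def
    by (rule derivative_eq_intros DC_within DS_within f g that refl)+ (simp add: algebra_simps)
  from has_field_derivative_zero_constant[OF _ this]
  obtain k where "\<And>t. t \<in> {0..l} \<Longrightarrow> p t = k" by auto
  then have p: "f x * C x - g x * S x = f 0"
    using x 0 by (metis p_def C0 S0 mult.right_neutral mult_zero_right diff_zero)
  have "(q has_real_derivative 0) (at t within {0..l})" if "t \<in> {0..l}" for t
    unfolding q_def
    by (rule derivative_eq_intros DC_within DS_within f g that refl)+ (simp add: algebra_simps)
  from has_field_derivative_zero_constant[OF _ this]
  obtain k where k: "\<And>t. t \<in> {0..l} \<Longrightarrow> q t = k" by auto
  have q: "lam * (f x * S x) + g x * C x = g 0"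
    using k[OF x] k[OF 0] by (simp add: q_def C0 S0)
  have "f 0 * C x + g 0 * S x = f x * (C x * C x + lam * (S x * S x))"
    unfolding p[symmetric] q[symmetric] by (simp add: algebra_simps)
  then show "f x = f 0 * C x + g 0 * S x" by (simp add: energy)
  have "- lam * f 0 * S x + g 0 * C x = g x * (C x * C x + lam * (S x * S x))"
    unfolding p[symmetric] q[symmetric] by (simp add: algebra_simps)
  then show "g x = - lam * f 0 * S x + g 0 * C x" by (simp add: energy)
qed

lemma double_angle:
  assumes "x \<ge> 0"
  shows "S (2 * x) = 2 * (S x * C x)" and "C (2 * x) = C x * C x - lam * (S x * S x)"
proof -
  have "((\<lambda>t. S (t + x)) has_real_derivative C (t + x)) (at t within {0..x})" for t
    using DS DERIV_shift has_field_derivative_at_within by blast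
  moreover have "((\<lambda>t. C (t + x)) has_real_derivative - lam * S (t + x)) (at t within {0..x})" for t
    using DC DERIV_shift has_field_derivative_at_within by blast
  ultimately show "S (2 * x) = 2 * (S x * C x)" "C (2 * x) = C x * C x - lam * (S x * S x)"
    using solution_unique[where f="\<lambda>t. S (t + x)" and g="\<lambda>t. C (t + x)" and l=x and x=x] assms
    by (auto simp: algebra_simps simp flip: mult_2)
qed

text \<open>Odd reflection: a solution vanishes at \<open>l\<close> exactly if it is odd about
  \<open>l\<close>, so that at distance \<open>2 * l\<close> its value is \<open>- p\<close> and its
  slope is again \<open>q\<close>. Both defects are multiples of the value at \<open>l\<close>, with
  factors \<open>2 * C l\<close> and \<open>2 * lam * S l\<close>, and \<open>energy\<close>
  excludes that both factors vanish.\<close>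

lemma zero_iff_reflected:
  assumes "l \<ge> 0"
  shows "p * C l + q * S l = 0 \<longleftrightarrow>
    C (2 * l) * p + S (2 * l) * q = - p \<and> lam * S (2 * l) * p - C (2 * l) * q = - q"
proof -
  have 1: "C (2 * l) * p + S (2 * l) * q + p = 2 * C l * (p * C l + q * S l)"
    unfolding double_angle[OF assms] using energy[of l] by algebra
  have 2: "lam * S (2 * l) * p - C (2 * l) * q + q = 2 * lam * S l * (p * C l + q * S l)"
    unfolding double_angle[OF assms] using energy[of l] by algebra
  show ?thesis
  proof
    assume "p * C l + q * S l = 0"
    with 1 2 show "C (2 * l) * p + S (2 * l) * q = - p \<and> lam * S (2 * l) * p - C (2 * l) * q = - q"
      by simp
  next
    assume "C (2 * l) * p + S (2 * l) * q = - p \<and> lam * S (2 * l) * p - C (2 * l) * q = - q"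
    then have 3: "2 * C l * (p * C l + q * S l) = 0" "2 * lam * S l * (p * C l + q * S l) = 0"
      using 1 2 by linarith+
    have "2 * ((C l * C l + lam * (S l * S l)) * (p * C l + q * S l)) =
        C l * (2 * C l * (p * C l + q * S l)) + S l * (2 * lam * S l * (p * C l + q * S l))"
      by (simp add: algebra_simps)
    also have "\<dots> = 0" unfolding 3 by simp
    finally have "(C l * C l + lam * (S l * S l)) * (p * C l + q * S l) = 0" by simp
    then show "p * C l + q * S l = 0" by (simp add: energy)
  qed
qed

end

text \<open>Regularity bootstrap from an equation that holds only almost everywhere:
  \<open>f1\<close> is continuous as an indefinite integral, so \<open>f\<close> is differentiable,
  so \<open>h\<close> is continuous and may replace \<open>f2\<close> under the integral. Continuity
  of \<open>h\<close> is assumed conditionally because for eigenfunctions \<open>h\<close> is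
  \<open>- lam\<close> times \<open>f\<close> itself.\<close>

lemma H2_edge_derivatives:
  assumes H: "H2_edge l f f1 f2" and h: "continuous_on {0..l} f \<Longrightarrow> continuous_on {0..l} h"
    and ae: "negligible {x \<in> {0..l}. f2 x \<noteq> h x}" and t: "t \<in> {0..l}"
  shows "(f has_real_derivative f1 t) (at t within {0..l})"
    and "(f1 has_real_derivative h t) (at t within {0..l})"
proof -
  have i2: "f2 integrable_on {0..l}"
    using H unfolding H2_edge_def absolutely_integrable_on_def by blast
  have f1: "f1 x = f1 0 + integral {0..x} f2" and f: "f x = f 0 + integral {0..x} f1"
    if "x \<in> {0..l}" for x
    using H that unfolding H2_edge_def by blast+
  have "continuous_on {0..l} (\<lambda>x. f1 0 + integral {0..x} f2)"
    by (intro continuous_intros indefinite_integral_continuous_1 i2)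
  then have c1: "continuous_on {0..l} f1"
    using f1 continuous_on_cong by (metis (no_types, lifting))
  have d: "((\<lambda>x. integral {0..x} f1) has_real_derivative f1 t) (at t within {0..l})"
    if "t \<in> {0..l}" for t
    using integral_has_real_derivative[OF c1 that] .
  have df: "(f has_real_derivative f1 t) (at t within {0..l})" if "t \<in> {0..l}" for t
  proof (rule has_field_derivative_transform_within[where d=1 and f="\<lambda>x. f 0 + integral {0..x} f1"])
    show "((\<lambda>x. f 0 + integral {0..x} f1) has_real_derivative f1 t) (at t within {0..l})"
      using DERIV_add[OF DERIV_const d[OF that]] by simp
    show "f 0 + integral {0..x} f1 = f x" if "x \<in> {0..l}" for x
      using f[OF that] by simp
  qed (use that in simp_all)
  then show "(f has_real_derivative f1 t) (at t within {0..l})" using t .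
  have "continuous_on {0..l} f"
    using df by (meson DERIV_continuous continuous_on_eq_continuous_within)
  then have ch: "continuous_on {0..l} h" by (rule h)
  have eq: "integral {0..x} f2 = integral {0..x} h" if "x \<in> {0..l}" for x
    by (rule integral_spike[OF ae]) (use that in auto)
  show "(f1 has_real_derivative h t) (at t within {0..l})"
  proof (rule has_field_derivative_transform_within[where d=1 and f="\<lambda>x. f1 0 + integral {0..x} h"])
    show "((\<lambda>x. f1 0 + integral {0..x} h) has_real_derivative h t) (at t within {0..l})"
      using DERIV_add[OF DERIV_const integral_has_real_derivative[OF ch t]] by simp
    show "f1 0 + integral {0..x} h = f1 x" if "x \<in> {0..l}" for x
      using f1[OF that] eq[OF that] by simp
  qed (use t in simp_all)
qed

lemma H2_edgeI:
  assumes f: "\<And>t. t \<in> {0..l} \<Longrightarrow> (f has_real_derivative f1 t) (at t within {0..l})"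
    and f1: "\<And>t. t \<in> {0..l} \<Longrightarrow> (f1 has_real_derivative f2 t) (at t within {0..l})"
    and f2: "continuous_on {0..l} f2"
  shows "H2_edge l f f1 f2"
proof -
  have "f1 x - f1 0 = integral {0..x} f2" "f x - f 0 = integral {0..x} f1" if "x \<in> {0..l}" for x
  proof -
    have sub: "{0..x} \<subseteq> {0..l}" using that by auto
    show "f1 x - f1 0 = integral {0..x} f2"
      by (rule integral_unique[symmetric], rule fundamental_theorem_of_calculus)
        (use that DERIV_subset[OF f1 sub] in
          \<open>auto simp flip: has_real_derivative_iff_has_vector_derivative\<close>)
    show "f x - f 0 = integral {0..x} f1"
      by (rule integral_unique[symmetric], rule fundamental_theorem_of_calculus)
        (use that DERIV_subset[OF f sub] in
          \<open>auto simp flip: has_real_derivative_iff_has_vector_derivative\<close>)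
  qed
  moreover have "f2 absolutely_integrable_on {0..l}"
    using absolutely_integrable_continuous_real[OF f2] .
  moreover have "(\<lambda>x. (f2 x)^2) integrable_on {0..l}"
    by (intro integrable_continuous_real continuous_intros f2)
  ultimately show ?thesis unfolding H2_edge_def by (metis add.commute diff_add_cancel)
qed

section \<open>Vertex conditions\<close>

definition kirchhoff_sum :: "mgraph \<Rightarrow> (nat \<Rightarrow> real \<Rightarrow> real) \<Rightarrow> nat \<Rightarrow> real" where
  "kirchhoff_sum G phi1 v = (\<Sum>i\<in>edges G.
     (if src G i = v then - phi1 i 0 else 0) + (if tgt G i = v then phi1 i (len G i) else 0))"

lemma kirchhoff_sum_eq:
  "kirchhoff_sum G phi1 v = (\<Sum>i\<in>{i \<in> edges G. src G i = v}. - phi1 i 0)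
     + (\<Sum>i\<in>{i \<in> edges G. tgt G i = v}. phi1 i (len G i))"
proof -
  have "finite (edges G)" by (simp add: edges_def)
  then show ?thesis by (simp add: kirchhoff_sum_def sum.distrib sum.inter_filter)
qed

lemma deg_pos_iff: "deg G v > 0 \<longleftrightarrow> (\<exists>i. incident G v i)"
  by (auto simp: deg_def incident_def card_gt_0_iff edges_def)

text \<open>Continuity at the vertices of higher degree and the Dirichlet condition merge into one
  function \<open>p\<close> of vertex values. Without loops, \<open>val_at\<close> reads off both
  ends of every edge.\<close>

lemma DSBC_iff_vertex_values:
  assumes noloop: "\<And>i. i \<in> edges G \<Longrightarrow> src G i \<noteq> tgt G i"
  shows "DSBC G phi phi1 phi2 \<longleftrightarrow>
    (\<forall>i\<in>edges G. H2_edge (len G i) (phi i) (phi1 i) (phi2 i)) \<and>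
    (\<exists>p. (\<forall>i\<in>edges G. phi i 0 = p (src G i) \<and> phi i (len G i) = p (tgt G i)) \<and>
         (\<forall>v. deg G v = 1 \<longrightarrow> p v = 0)) \<and>
    (\<forall>v. deg G v \<noteq> 1 \<longrightarrow> kirchhoff_sum G phi1 v = 0)"
    (is "_ \<longleftrightarrow> ?H \<and> (\<exists>p. ?V p \<and> ?D p) \<and> ?K")
proof
  assume D: "DSBC G phi phi1 phi2"
  define p where "p v = val_at G phi (SOME i. incident G v i) v" for v
  have p: "p v = val_at G phi i v" and p0: "deg G v = 1 \<Longrightarrow> p v = 0" if i: "incident G v i" for v i
  proof -
    have s: "incident G v (SOME i. incident G v i)" using i by (rule someI)
    have "deg G v > 0" using i deg_pos_iff by blast
    then consider "deg G v = 1" | "deg G v \<ge> 2" by linarith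
    then show "p v = val_at G phi i v"
    proof cases
      case 1
      with D i s have "val_at G phi i v = 0" "p v = 0" unfolding DSBC_def p_def by blast+
      then show ?thesis by simp
    next
      case 2
      with D i s show ?thesis unfolding DSBC_def p_def by blast
    qed
    show "p v = 0" if "deg G v = 1"
      using D s that unfolding DSBC_def p_def by blast
  qed
  have "?V p"
  proof
    fix i assume i: "i \<in> edges G"
    have "p (src G i) = val_at G phi i (src G i)" "p (tgt G i) = val_at G phi i (tgt G i)"
      by (rule p, use i in \<open>simp add: incident_def\<close>)+
    with noloop[OF i] show "phi i 0 = p (src G i) \<and> phi i (len G i) = p (tgt G i)"
      by (simp add: val_at_def)
  qed
  moreover have "?D p"
    using p0 deg_pos_iff by (metis zero_less_one)
  ultimately show "?H \<and> (\<exists>p. ?V p \<and> ?D p) \<and> ?K"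
    using D unfolding DSBC_def kirchhoff_sum_eq by blast
next
  assume R: "?H \<and> (\<exists>p. ?V p \<and> ?D p) \<and> ?K"
  then obtain p where V: "?V p" and D: "?D p" by blast
  have "val_at G phi i v = p v" if "incident G v i" for v i
    using that V by (auto simp: incident_def val_at_def)
  then show "DSBC G phi phi1 phi2"
    using R D unfolding DSBC_def kirchhoff_sum_eq by simp
qed

section \<open>The combinatorics and vertex conditions of \<open>G1\<close>\<close>

lemma all_less_15_iff: "(\<forall>i<15. P i) \<longleftrightarrow> P 0 \<and> P 1 \<and> P 2 \<and> P 3 \<and> P 4 \<and> P 5 \<and> P 6 \<and> P 7 \<and>
   P 8 \<and> P 9 \<and> P 10 \<and> P 11 \<and> P 12 \<and> P 13 \<and> P (14::nat)"
  by (simp add: eval_nat_numeral All_less_Suc conj_commute conj_left_commute)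

lemma sum_less_15: "sum f {..<15} = f 0 + f 1 + f 2 + f 3 + f 4 + f 5 + f 6 + f 7 +
   f 8 + f 9 + f 10 + f 11 + f 12 + f 13 + f (14::nat)" for f :: "nat \<Rightarrow> 'a::comm_monoid_add"
  by (simp add: eval_nat_numeral)

lemma edges_G1: "edges (G1 a b c) = {..<15}"
  by (simp add: edges_def G1_def)

lemma G2_eq: "G2 a b c = G1 a c b"
  by (simp add: G1_def G2_def)

lemma G1_simps [simp]:
  "src (G1 a b c) 0 = 0" "src (G1 a b c) 1 = 0" "src (G1 a b c) (Suc 0) = 0"
  "src (G1 a b c) 2 = 0" "src (G1 a b c) 3 = 1" "src (G1 a b c) 4 = 2" "src (G1 a b c) 5 = 3"
  "src (G1 a b c) 6 = 1" "src (G1 a b c) 7 = 2" "src (G1 a b c) 8 = 3"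
  "src (G1 a b c) 9 = 4" "src (G1 a b c) 10 = 4" "src (G1 a b c) 11 = 5"
  "src (G1 a b c) 12 = 5" "src (G1 a b c) 13 = 6" "src (G1 a b c) 14 = 6"
  "len (G1 a b c) 0 = 2 * c" "len (G1 a b c) 1 = 2 * a" "len (G1 a b c) (Suc 0) = 2 * a"
  "len (G1 a b c) 2 = 2 * b" "len (G1 a b c) 3 = 2 * b" "len (G1 a b c) 4 = 2 * c"
  "len (G1 a b c) 5 = 2 * a"
  "len (G1 a b c) 6 = a" "len (G1 a b c) 7 = b" "len (G1 a b c) 8 = c"
  "len (G1 a b c) 9 = a" "len (G1 a b c) 10 = c" "len (G1 a b c) 11 = a"
  "len (G1 a b c) 12 = b" "len (G1 a b c) 13 = b" "len (G1 a b c) 14 = c"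
  by (simp_all add: src_def len_def G1_def)

text \<open>In this numbering edge \<open>i\<close> is the one that leads to vertex
  \<open>Suc i\<close> from the side of the centre, so edges and vertices other than the centre
  correspond.\<close>

lemma tgt_G1 [simp]: "i < 15 \<Longrightarrow> tgt (G1 a b c) i = Suc i"
proof -
  have "\<forall>i<15. tgt (G1 a b c) i = Suc i" 
    unfolding all_less_15_iff by (simp add: tgt_def G1_def)
  then show "i < 15 \<Longrightarrow> tgt (G1 a b c) i = Suc i" by simp
qed

lemma src_G1_le: "i < 15 \<Longrightarrow> src (G1 a b c) i \<le> i"
proof -
  have "\<forall>i<15. src (G1 a b c) i \<le> i" unfolding all_less_15_iff by simp
  then show "i < 15 \<Longrightarrow> src (G1 a b c) i \<le> i" by simp
qed

lemma src_G1_less_7: "i < 15 \<Longrightarrow> src (G1 a b c) i < 7"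
proof -
  have "\<forall>i<15. src (G1 a b c) i < 7" unfolding all_less_15_iff by simp
  then show "i < 15 \<Longrightarrow> src (G1 a b c) i < 7" by simp
qed

lemma len_G1_pos:
  assumes "a > 0" "b > 0" "c > 0" "i < 15"
  shows "len (G1 a b c) i > 0"
proof -
  have "\<forall>i<15. len (G1 a b c) i > 0" unfolding all_less_15_iff using assms by simp
  then show ?thesis using assms by blast
qed

lemma less_7_cases:
  "(i::nat) < 7 \<Longrightarrow> i = 0 \<or> i = 1 \<or> i = 2 \<or> i = 3 \<or> i = 4 \<or> i = 5 \<or> i = 6"
  by linarith

lemma all_less_7_iff: "(\<forall>v<7. P v) \<longleftrightarrow> P 0 \<and> P 1 \<and> P 2 \<and> P 3 \<and> P 4 \<and> P 5 \<and> P (6::nat)"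
  using less_7_cases by fastforce

lemma deg_G1: "deg (G1 a b c) v = (if v < 7 then 3 else if v < 16 then 1 else 0)"
proof -
  have t: "{i \<in> edges (G1 a b c). tgt (G1 a b c) i = v} = (if 1 \<le> v \<and> v < 16 then {v - 1} else {})"
    by (auto simp: edges_G1)
  have "card {i \<in> edges (G1 a b c). src (G1 a b c) i = v} =
      (\<Sum>i<15. if src (G1 a b c) i = v then 1 else 0)"
    by (simp add: edges_G1 sum.inter_filter[symmetric] card_eq_sum del: sum_constant)
  also have "\<dots> = (if v = 0 then 3 else if v < 7 then 2 else 0)"
    unfolding sum_less_15 G1_simps
    by (cases "v < 7") (auto dest!: less_7_cases)
  finally show ?thesis unfolding deg_def t by auto
qed

lemma DSBC_G1_iff:
  "DSBC (G1 a b c) phi phi1 phi2 \<longleftrightarrow>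
    (\<forall>i<15. H2_edge (len (G1 a b c) i) (phi i) (phi1 i) (phi2 i)) \<and>
    (\<exists>p. (\<forall>i<15. phi i 0 = p (src (G1 a b c) i) \<and> phi i (len (G1 a b c) i) = p (Suc i)) \<and>
         (\<forall>v\<in>{7..15}. p v = 0)) \<and>
    phi1 0 0 + phi1 1 0 + phi1 2 0 = 0 \<and>
    phi1 3 0 + phi1 6 0 = phi1 0 (2 * c) \<and>
    phi1 4 0 + phi1 7 0 = phi1 1 (2 * a) \<and>
    phi1 5 0 + phi1 8 0 = phi1 2 (2 * b) \<and>
    phi1 9 0 + phi1 10 0 = phi1 3 (2 * b) \<and>
    phi1 11 0 + phi1 12 0 = phi1 4 (2 * c) \<and>
    phi1 13 0 + phi1 14 0 = phi1 5 (2 * a)"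
proof -
  have noloop: "src (G1 a b c) i \<noteq> tgt (G1 a b c) i" if "i \<in> edges (G1 a b c)" for i
    using that src_G1_le[of i a b c] by (auto simp: edges_G1)
  have 1: "deg (G1 a b c) v = 1 \<longleftrightarrow> v \<in> {7..15}" for v by (auto simp: deg_G1)
  have K: "(\<forall>v. deg (G1 a b c) v \<noteq> 1 \<longrightarrow> kirchhoff_sum (G1 a b c) phi1 v = 0) \<longleftrightarrow>
      (\<forall>v<7. kirchhoff_sum (G1 a b c) phi1 v = 0)" (is "?l \<longleftrightarrow> ?r")
  proof
    assume ?r
    \<comment> \<open>\<open>DSBC\<close> ranges over all natural numbers; those from 16 on have
      degree 0 and give an empty Kirchhoff sum.\<close>
    moreover have "kirchhoff_sum (G1 a b c) phi1 v = 0" if "v \<ge> 16" for v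
      using that src_G1_less_7[of _ a b c] unfolding kirchhoff_sum_def edges_G1
      by (intro sum.neutral) fastforce
    moreover have "v < 7 \<or> v \<ge> 16" if "v \<notin> {7..15}" for v :: nat using that by auto
    ultimately show ?l unfolding 1 by blast
  qed (simp add: deg_G1)
  have e: "(\<forall>i\<in>{..<15}. P i) \<longleftrightarrow> (\<forall>i<15. P i)" for P :: "nat \<Rightarrow> bool" by auto
  have V: "(\<forall>i<15. phi i 0 = p (src (G1 a b c) i) \<and> phi i (len (G1 a b c) i) = p (tgt (G1 a b c) i)) \<longleftrightarrow>
      (\<forall>i<15. phi i 0 = p (src (G1 a b c) i) \<and> phi i (len (G1 a b c) i) = p (Suc i))" for p
    by auto
  have b: "(\<forall>v. v \<in> {7..15} \<longrightarrow> P v) \<longleftrightarrow> (\<forall>v\<in>{7..15}. P v)" for P :: "nat \<Rightarrow> bool" by auto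
  have "kirchhoff_sum (G1 a b c) phi1 0 = - (phi1 0 0 + phi1 1 0 + phi1 2 0)"
    "kirchhoff_sum (G1 a b c) phi1 1 = phi1 0 (2 * c) - (phi1 3 0 + phi1 6 0)"
    "kirchhoff_sum (G1 a b c) phi1 2 = phi1 1 (2 * a) - (phi1 4 0 + phi1 7 0)"
    "kirchhoff_sum (G1 a b c) phi1 3 = phi1 2 (2 * b) - (phi1 5 0 + phi1 8 0)"
    "kirchhoff_sum (G1 a b c) phi1 4 = phi1 3 (2 * b) - (phi1 9 0 + phi1 10 0)"
    "kirchhoff_sum (G1 a b c) phi1 5 = phi1 4 (2 * c) - (phi1 11 0 + phi1 12 0)"
    "kirchhoff_sum (G1 a b c) phi1 6 = phi1 5 (2 * a) - (phi1 13 0 + phi1 14 0)"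
    unfolding kirchhoff_sum_def edges_G1 sum_less_15 by simp_all
  then have S: "(\<forall>v<7. kirchhoff_sum (G1 a b c) phi1 v = 0) \<longleftrightarrow>
      phi1 0 0 + phi1 1 0 + phi1 2 0 = 0 \<and> phi1 3 0 + phi1 6 0 = phi1 0 (2 * c) \<and>
      phi1 4 0 + phi1 7 0 = phi1 1 (2 * a) \<and> phi1 5 0 + phi1 8 0 = phi1 2 (2 * b) \<and>
      phi1 9 0 + phi1 10 0 = phi1 3 (2 * b) \<and> phi1 11 0 + phi1 12 0 = phi1 4 (2 * c) \<and>
      phi1 13 0 + phi1 14 0 = phi1 5 (2 * a)"
    unfolding all_less_7_iff by linarith
  have D: "DSBC (G1 a b c) phi phi1 phi2 \<longleftrightarrow>
    (\<forall>i\<in>edges (G1 a b c). H2_edge (len (G1 a b c) i) (phi i) (phi1 i) (phi2 i)) \<and>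
    (\<exists>p. (\<forall>i\<in>edges (G1 a b c). phi i 0 = p (src (G1 a b c) i) \<and>
              phi i (len (G1 a b c) i) = p (tgt (G1 a b c) i)) \<and>
         (\<forall>v. deg (G1 a b c) v = 1 \<longrightarrow> p v = 0)) \<and>
    (\<forall>v. deg (G1 a b c) v \<noteq> 1 \<longrightarrow> kirchhoff_sum (G1 a b c) phi1 v = 0)"
    by (rule DSBC_iff_vertex_values) (rule noloop)
  show ?thesis
    unfolding D K S unfolding 1 edges_G1 e V b ..
qed

section \<open>Transplantation of eigenfunctions\<close>

text \<open>Cutting the long edges at their midpoints decomposes \<open>G1\<close> into seven tripods with legs of
  lengths \<open>a\<close>, \<open>b\<close>, \<open>c\<close>, numbered 1, 2, 3 and centred at the vertices 0, ..., 6. Leg \<open>s\<close> of tripod \<open>v\<close>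
  is glued to leg \<open>s\<close> of tripod \<open>glue s v\<close>; a fixed point of \<open>glue s\<close> is a pendant edge.\<close>

definition leg :: "nat \<Rightarrow> nat" where
  "leg i = [3, 1, 2, 2, 3, 1, 1, 2, 3, 1, 3, 1, 2, 2, 3] ! i"

definition glue :: "nat \<Rightarrow> nat \<Rightarrow> nat" where
  "glue s v = [[0, 1, 2, 3, 4, 5, 6], [2, 1, 0, 6, 4, 5, 3], [3, 4, 2, 0, 1, 5, 6], [1, 0, 5, 3, 4, 2, 6]] ! s ! v"

definition reflect :: "nat \<Rightarrow> (nat \<Rightarrow> real) \<Rightarrow> nat \<Rightarrow> real" where
  "reflect s f v = (if glue s v = v then - f v else f (glue s v))"

text \<open>The matrix \<open>T\<close> is a solution of \<open>T A\<^sub>s = B\<^sub>s T\<close>, where \<open>A\<^sub>s\<close> and \<open>B\<^sub>s\<close> are the signed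
  permutations of the two graphs belonging to the leg \<open>s\<close> (\<open>transplant_reflect\<close>). Up to signs
  it is the incidence matrix of the Fano plane.\<close>

definition transplant :: "(nat \<Rightarrow> real) \<Rightarrow> nat \<Rightarrow> real" where
  "transplant f v = (\<Sum>w<7. [[0, 1, 1, 1, 0, 0, 0],
                             [1, 0, -1, 0, 1, 0, 0],
                             [1, -1, 0, 0, 0, 0, 1],
                             [1, 0, 0, -1, 0, 1, 0],
                             [0, 1, 0, 0, -1, -1, 0],
                             [0, 0, 0, 1, -1, 0, -1],
                             [0, 0, 1, 0, 0, -1, -1]] ! v ! w * f w)"

definition swap_legs :: "nat \<Rightarrow> nat" where
  "swap_legs s = (if s = 2 then 3 else if s = 3 then 2 else s)"

lemma sum_less_7: "sum f {..<7} = f 0 + f 1 + f 2 + f 3 + f 4 + f 5 + f (6::nat)"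
  for f :: "nat \<Rightarrow> 'a::comm_monoid_add"
  by (simp add: eval_nat_numeral)

lemma transplant_simps:
  "transplant f 0 = f 1 + f 2 + f 3"
  "transplant f 1 = f 0 - f 2 + f 4"
  "transplant f 2 = f 0 - f 1 + f 6"
  "transplant f 3 = f 0 - f 3 + f 5"
  "transplant f 4 = f 1 - f 4 - f 5"
  "transplant f 5 = f 3 - f 4 - f 6"
  "transplant f 6 = f 2 - f 5 - f 6"
  unfolding transplant_def sum_less_7 by simp_all

lemma transplant_cong: "(\<And>w. w < 7 \<Longrightarrow> f w = g w) \<Longrightarrow> transplant f v = transplant g v"
  unfolding transplant_def by (intro sum.cong) auto

lemma transplant_zero: "transplant (\<lambda>w. 0) v = 0"
  by (simp add: transplant_def)

lemma transplant_add: "transplant (\<lambda>w. f w + g w) v = transplant f v + transplant g v"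
  by (simp add: transplant_def distrib_left sum.distrib)

lemma transplant_diff: "transplant (\<lambda>w. f w - g w) v = transplant f v - transplant g v"
  by (simp add: transplant_def right_diff_distrib sum_subtractf)

lemma transplant_mult: "transplant (\<lambda>w. k * f w) v = k * transplant f v"
  by (simp add: transplant_def sum_distrib_left mult.left_commute)

lemma transplant_sum: "transplant (\<lambda>w. \<Sum>k\<in>K. f k w) v = (\<Sum>k\<in>K. transplant (f k) v)"
  unfolding transplant_def sum_distrib_left by (rule sum.swap)

text \<open>The signed permutation of the other graph for a leg is that of this graph for the leg of
  the same length, hence \<open>swap_legs\<close>. For each of the three legs it is a comparison of
  two 7 by 7 matrices.\<close>

lemma transplant_reflect:
  assumes "v < 7" and "s \<in> {1, 2, 3}"
  shows "transplant (reflect s f) v = reflect (swap_legs s) (transplant f) v"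
proof -
  consider "s = 1" | "s = 2" | "s = 3" using assms(2) by blast
  then have "\<forall>v<7. transplant (reflect s f) v = reflect (swap_legs s) (transplant f) v"
    unfolding all_less_7_iff transplant_simps
    by cases (simp_all add: reflect_def glue_def swap_legs_def transplant_simps[unfolded One_nat_def])
  then show ?thesis using assms by blast
qed

lemma transplant_eq_0:
  assumes "\<And>v. v < 7 \<Longrightarrow> transplant f v = 0" and "v < 7"
  shows "f v = 0"
proof -
  have "\<forall>v<7. transplant f v = 0" using assms by blast
  then have "\<forall>v<7. f v = 0"
    unfolding all_less_7_iff transplant_simps by (elim conjE) (intro conjI; linarith)
  then show ?thesis using assms by blast
qed

lemma swap_legs_in: "s \<in> {1, 2, 3} \<Longrightarrow> swap_legs s \<in> {1, 2, 3}"
  by (auto simp: swap_legs_def)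

lemma swap_legs_swap_legs: "swap_legs (swap_legs s) = s"
  by (auto simp: swap_legs_def)

lemma leg_simps [simp]:
  "leg 0 = 3" "leg 1 = 1" "leg (Suc 0) = 1" "leg 2 = 2" "leg 3 = 2" "leg 4 = 3" "leg 5 = 1"
  "leg 6 = 1" "leg 7 = 2" "leg 8 = 3" "leg 9 = 1" "leg 10 = 3" "leg 11 = 1" "leg 12 = 2"
  "leg 13 = 2" "leg 14 = 3"
  by (simp_all add: leg_def)

definition leg_len :: "real \<Rightarrow> real \<Rightarrow> real \<Rightarrow> nat \<Rightarrow> real" where
  "leg_len a b c s = (if s = 1 then a else if s = 2 then b else c)"

lemma leg_len_swap: "s \<in> {1, 2, 3} \<Longrightarrow> leg_len a c b s = leg_len a b c (swap_legs s)"
  by (auto simp: leg_len_def swap_legs_def)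

text \<open>Edges 0 to 5 are the long ones, each made of two glued legs; edges 6 to 14 are pendant
  and consist of a single leg.\<close>

lemma glue_inner: "i < 6 \<Longrightarrow> glue (leg i) (src (G1 a b c) i) = Suc i"
  and len_inner: "i < 6 \<Longrightarrow> len (G1 a b c) i = 2 * leg_len a b c (leg i)"
proof -
  have "\<forall>i<6. glue (leg i) (src (G1 a b c) i) = Suc i \<and> len (G1 a b c) i = 2 * leg_len a b c (leg i)"
    by (auto simp: eval_nat_numeral All_less_Suc2 glue_def leg_def leg_len_def G1_def src_def len_def)
  then show "i < 6 \<Longrightarrow> glue (leg i) (src (G1 a b c) i) = Suc i"
    and "i < 6 \<Longrightarrow> len (G1 a b c) i = 2 * leg_len a b c (leg i)" by simp_all
qed

lemma all_between_6_15: "(\<forall>i\<in>{6..<15}. P i) \<longleftrightarrow> P 6 \<and> P 7 \<and> P 8 \<and> P 9 \<and> P 10 \<and> P 11 \<and>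
    P 12 \<and> P 13 \<and> P (14::nat)"
proof -
  have "{6..<15} = {6, 7, 8, 9, 10, 11, 12, 13, 14::nat}" by auto
  then show ?thesis by auto
qed

lemma glue_outer: "i \<in> {6..<15} \<Longrightarrow> glue (leg i) (src (G1 a b c) i) = src (G1 a b c) i"
  and len_outer: "i \<in> {6..<15} \<Longrightarrow> len (G1 a b c) i = leg_len a b c (leg i)"
proof -
  have "\<forall>i\<in>{6..<15}. glue (leg i) (src (G1 a b c) i) = src (G1 a b c) i \<and>
      len (G1 a b c) i = leg_len a b c (leg i)"
    unfolding all_between_6_15 by (simp add: glue_def leg_len_def)
  then show "i \<in> {6..<15} \<Longrightarrow> glue (leg i) (src (G1 a b c) i) = src (G1 a b c) i"
    and "i \<in> {6..<15} \<Longrightarrow> len (G1 a b c) i = leg_len a b c (leg i)" by simp_all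
qed

lemma leg_in: "i < 15 \<Longrightarrow> leg i \<in> {1, 2, 3}"
proof -
  have "\<forall>i<15. leg i \<in> {1, 2, 3}" unfolding all_less_15_iff by simp
  then show "i < 15 \<Longrightarrow> leg i \<in> {1, 2, 3}" by blast
qed

section \<open>Eigenfunctions as linear data on the tripods\<close>

context fundamental_solutions
begin

text \<open>The numbers \<open>d 0 v\<close> and \<open>d s v\<close> are the value at \<open>v\<close> of an eigenfunction and its outward slope
  along leg \<open>s\<close>. The two equations at leg \<open>s\<close> continue the solution to distance twice
  the leg length: there it is the data of the glued tripod with reversed
  slope or, by odd reflection at a Dirichlet end, minus the data of \<open>v\<close> itself.\<close>

definition tripod_data :: "real \<Rightarrow> real \<Rightarrow> real \<Rightarrow> (nat \<Rightarrow> nat \<Rightarrow> real) \<Rightarrow> bool" where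
  "tripod_data a b c d \<longleftrightarrow> (\<forall>v<7. d 1 v + d 2 v + d 3 v = 0) \<and>
     (\<forall>s\<in>{1, 2, 3}. \<forall>v<7.
        C (2 * leg_len a b c s) * d 0 v + S (2 * leg_len a b c s) * d s v = reflect s (d 0) v \<and>
        lam * S (2 * leg_len a b c s) * d 0 v - C (2 * leg_len a b c s) * d s v = reflect s (d s) v)"

text \<open>The data at the inner end of an edge determine the solution on all of it. The value 0
  off the edge is what \<open>normalised\<close> demands.\<close>

definition edge_fun :: "mgraph \<Rightarrow> (nat \<Rightarrow> nat \<Rightarrow> real) \<Rightarrow> nat \<Rightarrow> real \<Rightarrow> real" where
  "edge_fun G d i x = (if i \<in> edges G \<and> x \<in> {0..len G i}
     then d 0 (src G i) * C x + d (leg i) (src G i) * S x else 0)"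

text \<open>The coefficients depend on the leg and not on \<open>v\<close>, so the matrix commutes
  with them and meets only \<open>reflect\<close>. Slopes along a leg of the new graph are built
  from slopes along legs of the same length, which keeps those coefficients equal.\<close>

lemma tripod_data_transplant:
  assumes "tripod_data a b c d"
  shows "tripod_data a c b (\<lambda>s. transplant (d (swap_legs s)))"
  unfolding tripod_data_def
proof (intro conjI allI impI ballI)
  fix v :: nat assume v: "v < 7"
  have "transplant (\<lambda>w. d 1 w + d 2 w + d 3 w) v = transplant (\<lambda>w. 0) v"
    by (rule transplant_cong) (use assms in \<open>simp add: tripod_data_def\<close>)
  then show "transplant (d (swap_legs 1)) v + transplant (d (swap_legs 2)) v
      + transplant (d (swap_legs 3)) v = 0"
    by (simp add: transplant_add transplant_zero swap_legs_def)
  fix s :: nat assume s: "s \<in> {1, 2, 3}"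
  let ?s = "swap_legs s"
  let ?l = "2 * leg_len a c b s"
  have s': "?s \<in> {1, 2, 3}" using s by (rule swap_legs_in)
  have l: "?l = 2 * leg_len a b c ?s" using s by (simp only: leg_len_swap)
  have 1: "C ?l * d 0 w + S ?l * d ?s w = reflect ?s (d 0) w" 
    "lam * S ?l * d 0 w - C ?l * d ?s w = reflect ?s (d ?s) w" if "w < 7" for w
    using assms that s' unfolding l tripod_data_def by blast+
  have 0: "swap_legs 0 = 0" by (simp add: swap_legs_def)
  have "transplant (\<lambda>w. C ?l * d 0 w + S ?l * d ?s w) v = transplant (reflect ?s (d 0)) v"
    by (rule transplant_cong) (rule 1(1))
  then show "C ?l * transplant (d (swap_legs 0)) v + S ?l * transplant (d ?s) v
      = reflect s (transplant (d (swap_legs 0))) v"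
    unfolding transplant_reflect[OF v s'] swap_legs_swap_legs 0
    by (simp only: transplant_add transplant_mult)
  have "transplant (\<lambda>w. lam * S ?l * d 0 w - C ?l * d ?s w) v = transplant (reflect ?s (d ?s)) v"
    by (rule transplant_cong) (rule 1(2))
  then show "lam * S ?l * transplant (d (swap_legs 0)) v - C ?l * transplant (d ?s) v
      = reflect s (transplant (d ?s)) v"
    unfolding transplant_reflect[OF v s'] swap_legs_swap_legs 0
    by (simp only: transplant_diff transplant_mult)
qed

lemma tripod_data_sum:
  assumes "\<And>k. k \<in> K \<Longrightarrow> tripod_data a b c (d k)"
  shows "tripod_data a b c (\<lambda>s v. \<Sum>k\<in>K. t k * d k s v)"
proof -
  have r: "reflect s (\<lambda>v. \<Sum>k\<in>K. t k * d k s' v) v = (\<Sum>k\<in>K. t k * reflect s (d k s') v)" for s s' v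
    by (simp add: reflect_def sum_negf)
  show ?thesis
    unfolding tripod_data_def r
  proof (intro conjI allI impI ballI)
    fix v :: nat assume v: "v < 7"
    have "(\<Sum>k\<in>K. t k * (d k 1 v + d k 2 v + d k 3 v)) = 0"
      using assms v by (intro sum.neutral) (simp add: tripod_data_def)
    then show "(\<Sum>k\<in>K. t k * d k 1 v) + (\<Sum>k\<in>K. t k * d k 2 v) + (\<Sum>k\<in>K. t k * d k 3 v) = 0"
      by (simp add: distrib_left sum.distrib)
    fix s :: nat assume s: "s \<in> {1, 2, 3}"
    let ?l = "2 * leg_len a b c s"
    have R: "C ?l * d k 0 v + S ?l * d k s v = reflect s (d k 0) v"
      "lam * S ?l * d k 0 v - C ?l * d k s v = reflect s (d k s) v" if "k \<in> K" for k
      using assms[OF that] v s unfolding tripod_data_def by blast+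
    have "(\<Sum>k\<in>K. t k * (C ?l * d k 0 v + S ?l * d k s v)) = (\<Sum>k\<in>K. t k * reflect s (d k 0) v)"
      "(\<Sum>k\<in>K. t k * (lam * S ?l * d k 0 v - C ?l * d k s v)) = (\<Sum>k\<in>K. t k * reflect s (d k s) v)"
      by (intro sum.cong refl arg_cong[where f="(*) _"] R; assumption)+
    then show "C ?l * (\<Sum>k\<in>K. t k * d k 0 v) + S ?l * (\<Sum>k\<in>K. t k * d k s v) = (\<Sum>k\<in>K. t k * reflect s (d k 0) v)"
      "lam * S ?l * (\<Sum>k\<in>K. t k * d k 0 v) - C ?l * (\<Sum>k\<in>K. t k * d k s v) = (\<Sum>k\<in>K. t k * reflect s (d k s) v)"
      by (simp_all add: sum_distrib_left sum.distrib sum_subtractf distrib_left right_diff_distrib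
          mult.left_commute mult.assoc)
  qed
qed

lemma edge_fun_sum: "edge_fun G (\<lambda>s v. \<Sum>k\<in>K. t k * d k s v) i x = (\<Sum>k\<in>K. t k * edge_fun G (d k) i x)"
  by (cases "i \<in> edges G \<and> x \<in> {0..len G i}")
    (auto simp: edge_fun_def sum.distrib sum_distrib_right distrib_left mult.assoc)

lemma independent:
  assumes l: "l > 0" and 0: "\<And>x. x \<in> {0..l} \<Longrightarrow> p * C x + q * S x = 0"
  shows "p = 0" and "q = 0"
proof -
  show p: "p = 0" using 0[of 0] l by (simp add: C0 S0)
  have "((\<lambda>x. q * S x) has_real_derivative q) (at 0 within {0..l})"
    using DERIV_cmult[OF DS_within[of 0 "{0..l}"], of q] by (simp add: C0)
  moreover have "((\<lambda>x. q * S x) has_real_derivative 0) (at 0 within {0..l})"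
    by (rule has_field_derivative_transform_within[where d=1 and f="\<lambda>_. 0"])
      (use 0 p l in auto)
  moreover have "at 0 within {0..l} \<noteq> bot"
    using l by (simp add: at_within_Icc_at_right)
  ultimately show "q = 0"
    using has_field_derivative_unique by blast
qed

lemma edge_fun_eq_0:
  assumes pos: "a > 0" "b > 0" "c > 0" and d: "tripod_data a b c d"
    and 0: "edge_fun (G1 a b c) d = (\<lambda>i x. 0)" and v: "v < 7" and s: "s \<le> 3"
  shows "d s v = 0"
proof -
  have e: "d 0 (src (G1 a b c) i) = 0" "d (leg i) (src (G1 a b c) i) = 0" if "i < 15" for i
  proof -
    have l: "len (G1 a b c) i > 0"
      using pos that by (rule len_G1_pos)
    have "d 0 (src (G1 a b c) i) * C x + d (leg i) (src (G1 a b c) i) * S x = 0"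
      if "x \<in> {0..len (G1 a b c) i}" for x
      using fun_cong[OF fun_cong[OF 0], of i x] that \<open>i < 15\<close> by (simp add: edge_fun_def edges_G1)
    from independent[OF l this]
    show "d 0 (src (G1 a b c) i) = 0" "d (leg i) (src (G1 a b c) i) = 0" by blast+
  qed
  \<comment> \<open>The slope at the far end of a long edge is not a coefficient of
    \<open>edge_fun\<close>; the reflection equation recovers it from the near end.\<close>
  have g: "d (leg i) (Suc i) = 0" if "i < 6" for i
  proof -
    have i: "i < 15" using that by simp
    let ?u = "src (G1 a b c) i" and ?l = "2 * leg_len a b c (leg i)"
    have ne: "glue (leg i) ?u \<noteq> ?u" using that glue_inner[OF that] src_G1_le[OF i, of a b c] by simp
    have "lam * S ?l * d 0 ?u - C ?l * d (leg i) ?u = reflect (leg i) (d (leg i)) ?u"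
      using d leg_in[OF i] src_G1_less_7[OF i] unfolding tripod_data_def by blast
    then show ?thesis
      using e[OF i] ne glue_inner[OF that] by (simp add: reflect_def)
  qed
  have E: "\<forall>i<15. d 0 (src (G1 a b c) i) = 0 \<and> d (leg i) (src (G1 a b c) i) = 0"
    using e by blast
  have "\<forall>v<7. d 0 v = 0 \<and> d 1 v = 0 \<and> d 2 v = 0 \<and> d 3 v = 0"
    using E g[of 0] g[of 1] g[of 2] g[of 3] g[of 4] g[of 5]
    unfolding all_less_15_iff all_less_7_iff by (simp flip: numeral_2_eq_2)
  moreover have "s = 0 \<or> s = 1 \<or> s = 2 \<or> s = 3" using s by linarith
  ultimately show ?thesis using v by blast
qed

text \<open>On a long edge the reflection equations say that value and slope at the far end agree
  with the data of the next tripod; on a pendant edge they say, by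
  \<open>zero_iff_reflected\<close>, that the solution vanishes at the end.\<close>

lemma edge_fun_in_eigenspace:
  assumes pos: "a > 0" "b > 0" "c > 0" and d: "tripod_data a b c d"
  shows "edge_fun (G1 a b c) d \<in> eigenspace (G1 a b c) lam"
proof -
  let ?G = "G1 a b c"
  let ?phi = "edge_fun ?G d"
  define phi1 where "phi1 i x = - lam * d 0 (src ?G i) * S x + d (leg i) (src ?G i) * C x" for i x
  define phi2 where "phi2 i x = - lam * (d 0 (src ?G i) * C x + d (leg i) (src ?G i) * S x)" for i x
  have len0: "len ?G i \<ge> 0" if "i < 15" for i
    using len_G1_pos[OF pos that] by simp
  have R: "C (2 * leg_len a b c (leg i)) * d 0 (src ?G i) + S (2 * leg_len a b c (leg i)) * d (leg i) (src ?G i)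
      = reflect (leg i) (d 0) (src ?G i)"
    "lam * S (2 * leg_len a b c (leg i)) * d 0 (src ?G i) - C (2 * leg_len a b c (leg i)) * d (leg i) (src ?G i)
      = reflect (leg i) (d (leg i)) (src ?G i)" if "i < 15" for i
    using d leg_in[OF that] src_G1_less_7[OF that] unfolding tripod_data_def by blast+
  have H: "H2_edge (len ?G i) (?phi i) (phi1 i) (phi2 i)" if i: "i < 15" for i
  proof (rule H2_edgeI)
    fix t assume t: "t \<in> {0..len ?G i}"
    show "(?phi i has_real_derivative phi1 i t) (at t within {0..len ?G i})"
    proof (rule has_field_derivative_transform_within[where d=1])
      show "((\<lambda>x. d 0 (src ?G i) * C x + d (leg i) (src ?G i) * S x) has_real_derivative phi1 i t)
          (at t within {0..len ?G i})"
        unfolding phi1_def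
        by (rule derivative_eq_intros DC_within DS_within refl)+ simp
    qed (use t i in \<open>auto simp: edge_fun_def edges_G1\<close>)
    show "(phi1 i has_real_derivative phi2 i t) (at t within {0..len ?G i})"
      unfolding phi1_def phi2_def
      by (rule derivative_eq_intros DC_within DS_within refl)+ (simp add: algebra_simps)
  next
    show "continuous_on {0..len ?G i} (phi2 i)"
      unfolding phi2_def
      by (intro continuous_intros DERIV_continuous_on[OF DC_within] DERIV_continuous_on[OF DS_within])
  qed
  define p where "p v = (if v < 7 then d 0 v else 0)" for v
  have V: "?phi i 0 = p (src ?G i) \<and> ?phi i (len ?G i) = p (Suc i)" if i: "i < 15" for i
  proof
    show "?phi i 0 = p (src ?G i)"
      using i len0[OF i] src_G1_less_7[OF i] by (simp add: edge_fun_def edges_G1 C0 S0 p_def)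
    have "d 0 (src ?G i) * C (len ?G i) + d (leg i) (src ?G i) * S (len ?G i) = p (Suc i)"
    proof (cases "i < 6")
      case True
      have "glue (leg i) (src ?G i) \<noteq> src ?G i" using glue_inner[OF True] src_G1_le[OF i, of a b c] by simp
      then show ?thesis
        using R[OF i] True by (simp add: reflect_def glue_inner len_inner p_def mult.commute)
    next
      case False
      then have o: "i \<in> {6..<15}" using i by simp
      have "leg_len a b c (leg i) \<ge> 0" using len0[OF i] len_outer[OF o] by simp
      from zero_iff_reflected[OF this]
      show ?thesis using R[OF i] o by (simp add: reflect_def glue_outer len_outer p_def)
    qed
    then show "?phi i (len ?G i) = p (Suc i)" using i len0[OF i] by (simp add: edge_fun_def edges_G1)
  qed
  have phi10: "phi1 i 0 = d (leg i) (src ?G i)" for i by (simp add: phi1_def C0 S0)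
  have phi1l: "phi1 i (2 * leg_len a b c (leg i)) = - d (leg i) (Suc i)" if "i < 6" for i
  proof -
    have i: "i < 15" using that by simp
    have "glue (leg i) (src ?G i) \<noteq> src ?G i" using glue_inner[OF that] src_G1_le[OF i, of a b c] by simp
    then show ?thesis
      using R(2)[OF i] that by (simp add: reflect_def glue_inner phi1_def algebra_simps)
  qed
  have K: "\<forall>v<7. d 1 v + d 2 v + d 3 v = 0" using d by (simp add: tripod_data_def)
  have "DSBC ?G ?phi phi1 phi2"
    unfolding DSBC_G1_iff
  proof (intro conjI exI[of _ p])
    show "\<forall>i<15. H2_edge (len ?G i) (?phi i) (phi1 i) (phi2 i)" using H by blast
    show "\<forall>i<15. ?phi i 0 = p (src ?G i) \<and> ?phi i (len ?G i) = p (Suc i)" using V by blast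
    show "\<forall>v\<in>{7..15}. p v = 0" by (simp add: p_def)
  qed (use K phi1l[of 0] phi1l[of 1] phi1l[of 2] phi1l[of 3] phi1l[of 4] phi1l[of 5] in
      \<open>simp_all add: all_less_7_iff phi10 leg_len_def eq_neg_iff_add_eq_0 add_ac flip: numeral_2_eq_2\<close>)
  moreover have "normalised ?G ?phi" by (simp add: normalised_def edge_fun_def)
  moreover have "\<forall>i\<in>edges ?G. negligible {x \<in> {0..len ?G i}. phi2 i x \<noteq> - lam * ?phi i x}"
  proof
    fix i assume "i \<in> edges ?G"
    then have "{x \<in> {0..len ?G i}. phi2 i x \<noteq> - lam * ?phi i x} = {}"
      by (auto simp: phi2_def edge_fun_def)
    then show "negligible {x \<in> {0..len ?G i}. phi2 i x \<noteq> - lam * ?phi i x}" by (simp only: negligible_empty)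
  qed
  ultimately show ?thesis unfolding eigenspace_def by blast
qed

lemma eigenspace_tripod_data:
  assumes pos: "a > 0" "b > 0" "c > 0" and phi: "phi \<in> eigenspace (G1 a b c) lam"
  obtains d where "tripod_data a b c d" and "phi = edge_fun (G1 a b c) d"
proof -
  let ?G = "G1 a b c"
  obtain phi1 phi2 where D: "DSBC ?G phi phi1 phi2" and n: "normalised ?G phi"
    and ae: "\<And>i. i \<in> edges ?G \<Longrightarrow> negligible {x \<in> {0..len ?G i}. phi2 i x \<noteq> - lam * phi i x}"
    using phi unfolding eigenspace_def by blast
  have H: "H2_edge (len ?G i) (phi i) (phi1 i) (phi2 i)" if "i < 15" for i
    using D that unfolding DSBC_G1_iff by blast
  obtain p where p: "\<And>i. i < 15 \<Longrightarrow> phi i 0 = p (src ?G i)"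
      "\<And>i. i < 15 \<Longrightarrow> phi i (len ?G i) = p (Suc i)" "\<And>v. v \<in> {7..15} \<Longrightarrow> p v = 0"
    using D unfolding DSBC_G1_iff by blast
  have len0: "len ?G i \<ge> 0" if "i < 15" for i
    using len_G1_pos[OF pos that] by simp
  have ode: "phi i x = p (src ?G i) * C x + phi1 i 0 * S x"
    "phi1 i x = - lam * p (src ?G i) * S x + phi1 i 0 * C x"
    if i: "i < 15" and x: "x \<in> {0..len ?G i}" for i x
  proof -
    have h: "continuous_on {0..len ?G i} (phi i) \<Longrightarrow> continuous_on {0..len ?G i} (\<lambda>x. - lam * phi i x)"
      by (intro continuous_intros)
    have "i \<in> edges ?G" using i by (simp add: edges_G1)
    note H2_edge_derivatives[OF H[OF i] h ae[OF this]]
    from solution_unique[OF this x] show "phi i x = p (src ?G i) * C x + phi1 i 0 * S x"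
      "phi1 i x = - lam * p (src ?G i) * S x + phi1 i 0 * C x"
      by (simp_all add: p(1)[OF i])
  qed
  \<comment> \<open>The last three rows list the slopes pointing away from \<open>v\<close> along
    leg \<open>s\<close>: \<open>phi1 i 0\<close> if edge \<open>i\<close> starts at
    \<open>v\<close>, and minus the derivative at the other end if it arrives there.\<close>
  define d where "d s v = [p v,
      [phi1 1 0, phi1 6 0, - phi1 1 (2*a), phi1 5 0, phi1 9 0, phi1 11 0, - phi1 5 (2*a)] ! v,
      [phi1 2 0, phi1 3 0, phi1 7 0, - phi1 2 (2*b), - phi1 3 (2*b), phi1 12 0, phi1 13 0] ! v,
      [phi1 0 0, - phi1 0 (2*c), phi1 4 0, phi1 8 0, phi1 10 0, - phi1 4 (2*c), phi1 14 0] ! v] ! s"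
    for s v
  have d0: "d 0 = p" by (simp add: d_def fun_eq_iff)
  have "\<forall>i<15. d (leg i) (src ?G i) = phi1 i 0"
    unfolding all_less_15_iff by (simp add: d_def)
  then have dsrc: "d (leg i) (src ?G i) = phi1 i 0" if "i < 15" for i using that by blast
  have "\<forall>i<6. d (leg i) (Suc i) = - phi1 i (len ?G i)"
    by (simp add: eval_nat_numeral All_less_Suc2 d_def leg_def G1_def len_def)
  then have dtgt: "d (leg i) (Suc i) = - phi1 i (len ?G i)" if "i < 6" for i using that by blast
  define R where "R s v \<longleftrightarrow>
     C (2 * leg_len a b c s) * d 0 v + S (2 * leg_len a b c s) * d s v = reflect s (d 0) v \<and>
     lam * S (2 * leg_len a b c s) * d 0 v - C (2 * leg_len a b c s) * d s v = reflect s (d s) v" for s v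
  have Rin: "R (leg i) (src ?G i)" "glue (leg i) (Suc i) = src ?G i \<Longrightarrow> R (leg i) (Suc i)" if "i < 6" for i
  proof -
    have i: "i < 15" using that by simp
    let ?u = "src ?G i" and ?l = "2 * leg_len a b c (leg i)"
    have g: "glue (leg i) ?u = Suc i" "Suc i \<noteq> ?u" using glue_inner[OF that] src_G1_le[OF i, of a b c] by simp_all
    have l: "len ?G i = ?l" using len_inner[OF that] .
    have in_l: "?l \<in> {0..len ?G i}" using len0[OF i] l by simp
    have 1: "d 0 (Suc i) = d 0 ?u * C ?l + d (leg i) ?u * S ?l"
      "d (leg i) (Suc i) = lam * d 0 ?u * S ?l - d (leg i) ?u * C ?l"
      using ode[OF i in_l] p(2)[OF i] dsrc[OF i] dtgt[OF that] by (simp_all add: d0 l)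
    then show "R (leg i) ?u" using g by (simp add: R_def reflect_def mult_ac)
    \<comment> \<open>By \<open>energy\<close> the matrix with rows (C, S) and (lam S, -C) is an
      involution, so the equations read from the far tripod follow from those read from the near
      one.\<close>
    have "C ?l * d 0 (Suc i) + S ?l * d (leg i) (Suc i) = d 0 ?u"
      "lam * S ?l * d 0 (Suc i) - C ?l * d (leg i) (Suc i) = d (leg i) ?u"
      unfolding 1 using energy[of ?l] by algebra+
    then show "R (leg i) (Suc i)" if "glue (leg i) (Suc i) = ?u"
      unfolding R_def reflect_def that using g(2)[symmetric] by simp
  qed
  have Rout: "R (leg i) (src ?G i)" if o: "i \<in> {6..<15}" for i
  proof -
    have i: "i < 15" using o by simp
    have l: "len ?G i = leg_len a b c (leg i)" using len_outer[OF o] .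
    have "d 0 (src ?G i) * C (len ?G i) + d (leg i) (src ?G i) * S (len ?G i) = 0"
      using ode(1)[OF i, of "len ?G i"] len0[OF i] p(2)[OF i] p(3)[of "Suc i"] o dsrc[OF i] by (simp add: d0)
    with zero_iff_reflected[OF len0[OF i]] show ?thesis
      unfolding R_def reflect_def glue_outer[OF o] l by simp
  qed
  \<comment> \<open>Of the 21 pairs of leg and tripod, the six long edges account for two each and
    the nine pendant edges for one each.\<close>
  have "\<forall>s\<in>{1, 2, 3}. \<forall>v<7. R s v"
    using Rin[of 0] Rin[of 1] Rin[of 2] Rin[of 3] Rin[of 4] Rin[of 5]
      Rout[of 6] Rout[of 7] Rout[of 8] Rout[of 9] Rout[of 10] Rout[of 11] Rout[of 12] Rout[of 13] Rout[of 14]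
    unfolding all_less_7_iff by (simp add: glue_def flip: numeral_2_eq_2)
  moreover have "\<forall>v<7. d 1 v + d 2 v + d 3 v = 0"
    using D unfolding DSBC_G1_iff all_less_7_iff d_def by simp
  ultimately have "tripod_data a b c d" by (simp add: tripod_data_def R_def)
  moreover have "phi = edge_fun ?G d"
  proof (intro ext)
    fix i x
    show "phi i x = edge_fun ?G d i x"
    proof (cases "i \<in> edges ?G \<and> x \<in> {0..len ?G i}")
      case True
      then have i: "i < 15" by (simp add: edges_G1)
      show ?thesis using True ode(1)[OF i, of x] dsrc[OF i] by (simp add: edge_fun_def d0)
    next
      case False
      then show ?thesis using n unfolding normalised_def edge_fun_def by meson
    qed
  qed
  ultimately show ?thesis by (rule that)
qed

text \<open>Multiplicity is a supremum of lengths of independent families, so it suffices that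
  transplantation is injective on tripod data. The reverse inequality is the same statement with
  \<open>b\<close> and \<open>c\<close> exchanged.\<close>

lemma multiplicity_le:
  assumes pos: "a > 0" "b > 0" "c > 0"
  shows "multiplicity (G1 a b c) lam \<le> multiplicity (G1 a c b) lam"
proof -
  have "\<exists>gs. length gs = length fs \<and> set gs \<subseteq> eigenspace (G1 a c b) lam \<and> lin_indep gs"
    if E: "set fs \<subseteq> eigenspace (G1 a b c) lam" and I: "lin_indep fs" for fs
  proof -
    have "\<exists>d. tripod_data a b c d \<and> fs ! k = edge_fun (G1 a b c) d" if "k < length fs" for k
      using eigenspace_tripod_data[OF pos] E that nth_mem by (metis subsetD)
    then obtain d where d: "\<And>k. k < length fs \<Longrightarrow> tripod_data a b c (d k)"
        and fs: "\<And>k. k < length fs \<Longrightarrow> fs ! k = edge_fun (G1 a b c) (d k)"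
      by metis
    define tr where "tr d = (\<lambda>s. transplant (d (swap_legs s)))" for d :: "nat \<Rightarrow> nat \<Rightarrow> real"
    define gs where "gs = map (\<lambda>k. edge_fun (G1 a c b) (tr (d k))) [0..<length fs]"
    have "set gs \<subseteq> eigenspace (G1 a c b) lam"
      using d edge_fun_in_eigenspace[OF pos(1,3,2) tripod_data_transplant]
      by (auto simp: gs_def tr_def)
    moreover have "lin_indep gs"
      unfolding lin_indep_def
    proof (intro allI impI)
      fix t :: "nat \<Rightarrow> real" and k
      assume 0: "(\<lambda>i x. \<Sum>k<length gs. t k * (gs ! k) i x) = (\<lambda>i x. 0)" and k: "k < length gs"
      \<comment> \<open>A linear relation between the transplanted functions says that the
        transplant of \<open>e\<close> gives the zero function; \<open>edge_fun_eq_0\<close> and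
        \<open>transplant_eq_0\<close> then annihilate \<open>e\<close>, which is the same relation
        between the original functions.\<close>
      define e where "e s v = (\<Sum>k<length fs. t k * d k s v)" for s v
      have e: "tripod_data a b c e"
        unfolding e_def by (rule tripod_data_sum) (use d in auto)
      have tr: "tr e = (\<lambda>s v. \<Sum>k<length fs. t k * tr (d k) s v)"
        by (simp add: tr_def e_def[abs_def] transplant_sum transplant_mult fun_eq_iff)
      have "edge_fun (G1 a c b) (tr e) = (\<lambda>i x. 0)"
        unfolding tr edge_fun_sum using 0 by (simp add: gs_def fun_eq_iff)
      then have "tr e s v = 0" if "v < 7" "s \<le> 3" for s v
        using edge_fun_eq_0[OF pos(1,3,2)] tripod_data_transplant[OF e] that unfolding tr_def by blast
      then have e0: "e (swap_legs s) v = 0" if "v < 7" "s \<le> 3" for s v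
        using transplant_eq_0[of "e (swap_legs s)" v] that by (simp add: tr_def)
      have e_0: "e s v = 0" if "v < 7" "s \<le> 3" for s v
        using e0[OF that(1), of "swap_legs s"] that(2) by (simp add: swap_legs_swap_legs) (simp add: swap_legs_def)
      have "edge_fun (G1 a b c) e i x = 0" for i x
        using leg_in[of i] src_G1_less_7[of i] e_0 by (auto simp: edge_fun_def edges_G1)
      then have "edge_fun (G1 a b c) e = (\<lambda>i x. 0)" by (simp add: fun_eq_iff)
      then have "(\<lambda>i x. \<Sum>k<length fs. t k * (fs ! k) i x) = (\<lambda>i x. 0)"
        unfolding e_def edge_fun_sum by (simp add: fs)
      with I k show "t k = 0" unfolding lin_indep_def by (simp add: gs_def)
    qed
    moreover have "length gs = length fs" by (simp add: gs_def)
    ultimately show ?thesis by blast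
  qed
  then have "{enat (length fs) | fs. set fs \<subseteq> eigenspace (G1 a b c) lam \<and> lin_indep fs}
      \<subseteq> {enat (length fs) | fs. set fs \<subseteq> eigenspace (G1 a c b) lam \<and> lin_indep fs}"
    by (smt (verit, ccfv_threshold) Collect_mono)
  then show ?thesis unfolding multiplicity_def by (rule Sup_subset_mono)
qed

end

lemma isospectral_G1:
  assumes "a > 0" "b > 0" "c > 0"
  shows "isospectral (G1 a b c) (G1 a c b)"
  unfolding isospectral_def
proof
  fix lam
  obtain C S where "\<And>x. (C has_real_derivative - lam * S x) (at x)"
      "\<And>x. (S has_real_derivative C x) (at x)" "C 0 = 1" "S 0 = 0"
    by (rule ex_fundamental_solutions[of lam]) (rule that)
  then interpret fundamental_solutions lam C S by unfold_locales
  show "multiplicity (G1 a b c) lam = multiplicity (G1 a c b) lam"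
    using multiplicity_le assms by (intro antisym)
qed

section \<open>Torsional rigidity\<close>

text \<open>The next four polynomials come from solving the linear system for the vertex values of the torsion
  function by elimination: \<open>tors_o\<close>, \<open>tors_m\<close>, \<open>tors_w\<close> are the numerators at the centre, at \<open>m\<^sub>1\<close> and
  at \<open>w\<^sub>1\<close>, over the common denominator \<open>tors_den\<close>. The other vertices follow from the
  symmetry of \<open>G1\<close> under cyclic permutation of \<open>(a, b, c)\<close>.\<close>

definition tors_den :: "real \<Rightarrow> real \<Rightarrow> real \<Rightarrow> real" where
  "tors_den a b c =
    64 * a^5 * b^3 + 192 * a^5 * b^2 * c + 192 * a^5 * b * c^2 + 64 * a^5 * c^3 + 144 * a^4 *
    b^4 + 704 * a^4 * b^3 * c + 1120 * a^4 * b^2 * c^2 + 704 * a^4 * b * c^3 + 144 * a^4 * c^4 +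
    64 * a^3 * b^5 + 704 * a^3 * b^4 * c + 1870 * a^3 * b^3 * c^2 + 1870 * a^3 * b^2 * c^3 + 704
    * a^3 * b * c^4 + 64 * a^3 * c^5 + 192 * a^2 * b^5 * c + 1120 * a^2 * b^4 * c^2 + 1870 * a^2
    * b^3 * c^3 + 1120 * a^2 * b^2 * c^4 + 192 * a^2 * b * c^5 + 192 * a * b^5 * c^2 + 704 * a *
    b^4 * c^3 + 704 * a * b^3 * c^4 + 192 * a * b^2 * c^5 + 64 * b^5 * c^3 + 144 * b^4 * c^4 +
    64 * b^3 * c^5"

definition tors_o :: "real \<Rightarrow> real \<Rightarrow> real \<Rightarrow> real" where
  "tors_o a b c =
    96 * a^6 * b^4 + 400 * a^6 * b^3 * c + 624 * a^6 * b^2 * c^2 + 432 * a^6 * b * c^3 + 112 *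
    a^6 * c^4 + 224 * a^5 * b^5 + 1436 * a^5 * b^4 * c + 3218 * a^5 * b^3 * c^2 + 3254 * a^5 *
    b^2 * c^3 + 1472 * a^5 * b * c^4 + 224 * a^5 * c^5 + 112 * a^4 * b^6 + 1472 * a^4 * b^5 * c
    + 5208 * a^4 * b^4 * c^2 + 7711 * a^4 * b^3 * c^3 + 5208 * a^4 * b^2 * c^4 + 1436 * a^4 * b
    * c^5 + 96 * a^4 * c^6 + 432 * a^3 * b^6 * c + 3254 * a^3 * b^5 * c^2 + 7711 * a^3 * b^4 *
    c^3 + 7711 * a^3 * b^3 * c^4 + 3218 * a^3 * b^2 * c^5 + 400 * a^3 * b * c^6 + 624 * a^2 *
    b^6 * c^2 + 3218 * a^2 * b^5 * c^3 + 5208 * a^2 * b^4 * c^4 + 3254 * a^2 * b^3 * c^5 + 624 *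
    a^2 * b^2 * c^6 + 400 * a * b^6 * c^3 + 1436 * a * b^5 * c^4 + 1472 * a * b^4 * c^5 + 432 *
    a * b^3 * c^6 + 96 * b^6 * c^4 + 224 * b^5 * c^5 + 112 * b^4 * c^6"

definition tors_m :: "real \<Rightarrow> real \<Rightarrow> real \<Rightarrow> real" where
  "tors_m a b c =
    96 * a^6 * b^4 + 368 * a^6 * b^3 * c + 528 * a^6 * b^2 * c^2 + 336 * a^6 * b * c^3 + 80 *
    a^6 * c^4 + 224 * a^5 * b^5 + 1292 * a^5 * b^4 * c + 2654 * a^5 * b^3 * c^2 + 2450 * a^5 *
    b^2 * c^3 + 992 * a^5 * b * c^4 + 128 * a^5 * c^5 + 112 * a^4 * b^6 + 1264 * a^4 * b^5 * c +
    3992 * a^4 * b^4 * c^2 + 5325 * a^4 * b^3 * c^3 + 3188 * a^4 * b^2 * c^4 + 756 * a^4 * b *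
    c^5 + 48 * a^4 * c^6 + 336 * a^3 * b^6 * c + 2182 * a^3 * b^5 * c^2 + 4549 * a^3 * b^4 * c^3
    + 3971 * a^3 * b^3 * c^4 + 1412 * a^3 * b^2 * c^5 + 160 * a^3 * b * c^6 + 336 * a^2 * b^6 *
    c^2 + 1462 * a^2 * b^5 * c^3 + 2012 * a^2 * b^4 * c^4 + 1048 * a^2 * b^3 * c^5 + 176 * a^2 *
    b^2 * c^6 + 112 * a * b^6 * c^3 + 320 * a * b^5 * c^4 + 264 * a * b^4 * c^5 + 64 * a * b^3 *
    c^6"

definition tors_w :: "real \<Rightarrow> real \<Rightarrow> real \<Rightarrow> real" where
  "tors_w a b c =
    80 * a^6 * b^3 * c + 240 * a^6 * b^2 * c^2 + 240 * a^6 * b * c^3 + 80 * a^6 * c^4 + 248 *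
    a^5 * b^4 * c + 1018 * a^5 * b^3 * c^2 + 1426 * a^5 * b^2 * c^3 + 784 * a^5 * b * c^4 + 128
    * a^5 * c^5 + 232 * a^4 * b^5 * c + 1396 * a^4 * b^4 * c^2 + 2687 * a^4 * b^3 * c^3 + 2092 *
    a^4 * b^2 * c^4 + 612 * a^4 * b * c^5 + 48 * a^4 * c^6 + 64 * a^3 * b^6 * c + 736 * a^3 *
    b^5 * c^2 + 2109 * a^3 * b^4 * c^3 + 2273 * a^3 * b^3 * c^4 + 956 * a^3 * b^2 * c^5 + 128 *
    a^3 * b * c^6 + 128 * a^2 * b^6 * c^2 + 680 * a^2 * b^5 * c^3 + 1064 * a^2 * b^4 * c^4 + 608
    * a^2 * b^3 * c^5 + 112 * a^2 * b^2 * c^6 + 64 * a * b^6 * c^3 + 176 * a * b^5 * c^4 + 136 *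
    a * b^4 * c^5 + 32 * a * b^3 * c^6"

text \<open>The cofactor of the Vandermonde product in the difference of the two torsional rigidities; what
  matters is that all its coefficients are positive.\<close>

definition tors_diff :: "real \<Rightarrow> real \<Rightarrow> real \<Rightarrow> real" where
  "tors_diff a b c =
    88 * a^5 * b^3 + 264 * a^5 * b^2 * c + 264 * a^5 * b * c^2 + 88 * a^5 * c^3 + 184 * a^4 *
    b^4 + 1016 * a^4 * b^3 * c + 1664 * a^4 * b^2 * c^2 + 1016 * a^4 * b * c^3 + 184 * a^4 * c^4
    + 88 * a^3 * b^5 + 1016 * a^3 * b^4 * c + 2904 * a^3 * b^3 * c^2 + 2904 * a^3 * b^2 * c^3 +
    1016 * a^3 * b * c^4 + 88 * a^3 * c^5 + 264 * a^2 * b^5 * c + 1664 * a^2 * b^4 * c^2 + 2904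
    * a^2 * b^3 * c^3 + 1664 * a^2 * b^2 * c^4 + 264 * a^2 * b * c^5 + 264 * a * b^5 * c^2 +
    1016 * a * b^4 * c^3 + 1016 * a * b^3 * c^4 + 264 * a * b^2 * c^5 + 88 * b^5 * c^3 + 184 *
    b^4 * c^4 + 88 * b^3 * c^5"


lemma tors_den_pos: "a > 0 \<Longrightarrow> b > 0 \<Longrightarrow> c > 0 \<Longrightarrow> tors_den a b c > 0"
  unfolding tors_den_def by (intro add_pos_pos mult_pos_pos zero_less_power) simp_all

lemma tors_diff_pos: "a > 0 \<Longrightarrow> b > 0 \<Longrightarrow> c > 0 \<Longrightarrow> tors_diff a b c > 0"
  unfolding tors_diff_def by (intro add_pos_pos mult_pos_pos zero_less_power) simp_all

lemma tors_den_rotate: "tors_den b c a = tors_den a b c"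
  unfolding tors_den_def by (simp add: mult_ac add_ac)

lemma tors_den_swap: "tors_den a c b = tors_den a b c"
  unfolding tors_den_def by (simp add: mult_ac add_ac)

lemma tors_o_rotate: "tors_o b c a = tors_o a b c"
  unfolding tors_o_def by (simp add: mult_ac add_ac)

text \<open>This and the next two identities are the Kirchhoff equations at the centre,
  \<open>m\<^sub>1\<close> and \<open>w\<^sub>1\<close>, multiplied by
  \<open>2 * a * b * c * tors_den a b c\<close>.\<close>

lemma tors_identity_o:
  "a * b * (tors_m a b c - tors_o a b c) + b * c * (tors_m b c a - tors_o a b c)
   + a * c * (tors_m c a b - tors_o a b c) + 2 * a * b * c * (a + b + c) * tors_den a b c = 0"
  unfolding tors_m_def tors_o_def tors_den_def by algebra

lemma tors_identity_m:
  "a * b * (tors_o a b c - tors_m a b c) + a * c * (tors_w a b c - tors_m a b c)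
   - 2 * b * c * tors_m a b c + a * b * c * (2 * c + 2 * b + a) * tors_den a b c = 0"
  unfolding tors_m_def tors_o_def tors_w_def tors_den_def by algebra

lemma tors_identity_w:
  "a * c * (tors_m a b c - tors_w a b c) - 2 * b * c * tors_w a b c - 2 * a * b * tors_w a b c
   + a * b * c * (2 * b + a + c) * tors_den a b c = 0"
  unfolding tors_m_def tors_w_def tors_den_def by algebra

text \<open>Each vertex value is weighted by the total length of the edges at that vertex; divided
  by \<open>2 * tors_den a b c\<close>, this is the part of the torsional rigidity that comes from
  the vertex values.\<close>

definition tors_num :: "real \<Rightarrow> real \<Rightarrow> real \<Rightarrow> real" where
  "tors_num a b c = 2 * (a + b + c) * tors_o a b c
     + (2 * c + 2 * b + a) * tors_m a b c + (2 * a + 2 * c + b) * tors_m b c a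
     + (2 * b + 2 * a + c) * tors_m c a b
     + (2 * b + a + c) * tors_w a b c + (2 * c + b + a) * tors_w b c a + (2 * a + c + b) * tors_w c a b"

text \<open>\<open>tors_num\<close> is invariant under cyclic permutation, so the difference is
  alternating in \<open>a\<close>, \<open>b\<close>, \<open>c\<close> and the Vandermonde product
  must divide it.\<close>

lemma tors_num_diff:
  "tors_num a b c - tors_num a c b = 2 * ((a - b) * (b - c) * (c - a)) * tors_diff a b c"
  unfolding tors_num_def tors_m_def tors_o_def tors_w_def tors_diff_def by algebra

section \<open>From vertex values to the torsional rigidity\<close>

text \<open>The function is a parabola fixed by its end values: a linear interpolation plus the
  torsion function of an interval with Dirichlet ends, whose integral is
  \<open>l ^ 3 / 12\<close>.\<close>

lemma torsion_edge:
  assumes l: "l > 0" and H: "H2_edge l f f1 f2" and ae: "negligible {x \<in> {0..l}. f2 x \<noteq> -1}"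
  shows "f1 0 = (f l - f 0) / l + l / 2" and "f1 l = (f l - f 0) / l - l / 2"
    and "integral {0..l} f = (f 0 + f l) / 2 * l + l ^ 3 / 12"
proof -
  note D = H2_edge_derivatives[OF H continuous_on_const ae]
  have l0: "0 \<in> {0..l}" "l \<in> {0..l}" using l by auto
  have f1: "f1 x = f1 0 - x" if "x \<in> {0..l}" for x
  proof -
    have "((\<lambda>x. f1 x + x) has_real_derivative 0) (at t within {0..l})" if "t \<in> {0..l}" for t
      using DERIV_add[OF D(2)[OF that] DERIV_ident] by simp
    from has_field_derivative_zero_constant[OF _ this]
    obtain k where "\<And>t. t \<in> {0..l} \<Longrightarrow> f1 t + t = k" by auto
    from this[OF that] this[OF l0(1)] show ?thesis by simp
  qed
  have f: "f x = f 0 + f1 0 * x - x ^ 2 / 2" if "x \<in> {0..l}" for x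
  proof -
    have "((\<lambda>x. f x - (f1 0 * x - x ^ 2 / 2)) has_real_derivative 0) (at t within {0..l})"
      if "t \<in> {0..l}" for t
      by (auto intro!: derivative_eq_intros D(1)[OF that] simp: f1[OF that])
    from has_field_derivative_zero_constant[OF _ this]
    obtain k where "\<And>t. t \<in> {0..l} \<Longrightarrow> f t - (f1 0 * t - t ^ 2 / 2) = k" by auto
    from this[OF that] this[OF l0(1)] show ?thesis by simp
  qed
  show s: "f1 0 = (f l - f 0) / l + l / 2"
    unfolding f[OF l0(2)] using l by (simp add: field_simps power2_eq_square)
  then show "f1 l = (f l - f 0) / l - l / 2" using f1[OF l0(2)] by simp
  have "((\<lambda>x. f 0 * x + f1 0 * x ^ 2 / 2 - x ^ 3 / 6) has_vector_derivative f x) (at x within {0..l})"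
    if "x \<in> {0..l}" for x
    unfolding has_real_derivative_iff_has_vector_derivative[symmetric]
    by (auto intro!: derivative_eq_intros simp: f[OF that])
  note integral_unique[OF fundamental_theorem_of_calculus[OF less_imp_le[OF l] this]]
  then have "integral {0..l} f = f 0 * l + f1 0 * l ^ 2 / 2 - l ^ 3 / 6"
    by simp
  also have "\<dots> = f 0 * l + (f l - f 0 + l ^ 2 / 2) * l / 2 - l ^ 3 / 6"
    unfolding f[OF l0(2)] by (simp add: power2_eq_square)
  finally have "integral {0..l} f = f 0 * l + (f l - f 0 + l ^ 2 / 2) * l / 2 - l ^ 3 / 6" .
  then show "integral {0..l} f = (f 0 + f l) / 2 * l + l ^ 3 / 12"
    by (simp add: field_simps power2_eq_square power3_eq_cube)
qed

lemma ex_torsion_edge: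
  fixes l p q :: real
  assumes l: "l > 0"
  shows "\<exists>f f1. H2_edge l f f1 (\<lambda>_. -1) \<and> f 0 = p \<and> f l = q"
proof -
  define s where "s = (q - p) / l + l / 2"
  have "H2_edge l (\<lambda>x. p + s * x - x ^ 2 / 2) (\<lambda>x. s - x) (\<lambda>_. -1)"
    by (rule H2_edgeI) (auto intro!: derivative_eq_intros)
  moreover have "p + s * l - l ^ 2 / 2 = q"
    using l by (simp add: s_def field_simps power2_eq_square)
  ultimately show ?thesis
    by (intro exI[of _ "\<lambda>x. p + s * x - x ^ 2 / 2"] exI[of _ "\<lambda>x. s - x"]) simp
qed

text \<open>The Kirchhoff conditions in terms of the vertex values: each edge contributes its slope
  away from the vertex, the difference quotient plus half the length, with value 0 at the pendant
  ends.\<close>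

definition torsion_values :: "real \<Rightarrow> real \<Rightarrow> real \<Rightarrow> (nat \<Rightarrow> real) \<Rightarrow> bool" where
  "torsion_values a b c p \<longleftrightarrow>
     (p 1 - p 0) / (2*c) + c + (p 2 - p 0) / (2*a) + a + (p 3 - p 0) / (2*b) + b = 0 \<and>
     (p 0 - p 1) / (2*c) + c + (p 4 - p 1) / (2*b) + b - p 1 / a + a / 2 = 0 \<and>
     (p 0 - p 2) / (2*a) + a + (p 5 - p 2) / (2*c) + c - p 2 / b + b / 2 = 0 \<and>
     (p 0 - p 3) / (2*b) + b + (p 6 - p 3) / (2*a) + a - p 3 / c + c / 2 = 0 \<and>
     (p 1 - p 4) / (2*b) + b - p 4 / a + a / 2 - p 4 / c + c / 2 = 0 \<and>
     (p 2 - p 5) / (2*c) + c - p 5 / b + b / 2 - p 5 / a + a / 2 = 0 \<and>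
     (p 3 - p 6) / (2*a) + a - p 6 / c + c / 2 - p 6 / b + b / 2 = 0"

text \<open>For each of \<open>a\<close>, \<open>b\<close>, \<open>c\<close> there are two edges of
  twice that length and three of that length, and 19 = 2 * 8 + 3.\<close>

definition torsion_value :: "real \<Rightarrow> real \<Rightarrow> real \<Rightarrow> (nat \<Rightarrow> real) \<Rightarrow> real" where
  "torsion_value a b c p = (2 * (a + b + c) * p 0
     + (2*c + 2*b + a) * p 1 + (2*a + 2*c + b) * p 2 + (2*b + 2*a + c) * p 3
     + (2*b + a + c) * p 4 + (2*c + b + a) * p 5 + (2*a + c + b) * p 6) / 2
     + 19 * (a ^ 3 + b ^ 3 + c ^ 3) / 12"

text \<open>The linear system is symmetric, and its right-hand side is also the vector of weights with which the
  vertex values enter the torsional rigidity; so the latter is determined even before the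
  solution is known to be unique.\<close>

lemma torsion_value_unique:
  assumes p: "torsion_values a b c p" and q: "torsion_values a b c q"
  shows "torsion_value a b c p = torsion_value a b c q"
proof -
  \<comment> \<open>With the reciprocals as separate variables the claim becomes a purely polynomial
    consequence of the two systems.\<close>
  define x y z where "x = 1 / (2*a)" and "y = 1 / (2*b)" and "z = 1 / (2*c)"
  have d: "t / (2*a) = t * x" "t / (2*b) = t * y" "t / (2*c) = t * z"
    "t / a = 2 * t * x" "t / b = 2 * t * y" "t / c = 2 * t * z" for t
    by (simp_all add: x_def y_def z_def)
  note E = p[unfolded torsion_values_def d] q[unfolded torsion_values_def d]
  have "2 * (a + b + c) * (p 0 - q 0)
     + (2*c + 2*b + a) * (p 1 - q 1) + (2*a + 2*c + b) * (p 2 - q 2) + (2*b + 2*a + c) * (p 3 - q 3)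
     + (2*b + a + c) * (p 4 - q 4) + (2*c + b + a) * (p 5 - q 5) + (2*a + c + b) * (p 6 - q 6) = 0"
    using E by algebra
  then show ?thesis unfolding torsion_value_def by (simp add: algebra_simps)
qed

text \<open>The definite description asks for a unique value rather than a unique function: every
  torsion function yields a solution of the linear system, on which \<open>torsion_value\<close> is
  constant, and the given \<open>p\<close> yields a torsion function.\<close>

lemma torsion_G1:
  assumes pos: "a > 0" "b > 0" "c > 0" and p: "torsion_values a b c p"
  shows "torsion (G1 a b c) = torsion_value a b c p"
proof -
  let ?G = "G1 a b c"
  have val: "t = torsion_value a b c p"
    if D: "DSBC ?G u u1 u2" and ae: "\<forall>i\<in>edges ?G. negligible {x \<in> {0..len ?G i}. u2 i x \<noteq> -1}"
      and t: "t = (\<Sum>i\<in>edges ?G. integral {0..len ?G i} (u i))" for t u u1 u2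
  proof -
    have H: "H2_edge (len ?G i) (u i) (u1 i) (u2 i)" if "i < 15" for i
      using D that unfolding DSBC_G1_iff by blast
    obtain q where q: "\<And>i. i < 15 \<Longrightarrow> u i 0 = q (src ?G i) \<and> u i (len ?G i) = q (Suc i)"
        and q0: "\<And>v. v \<in> {7..15} \<Longrightarrow> q v = 0"
      using D unfolding DSBC_G1_iff by blast
    have e: "u1 i 0 = (q (Suc i) - q (src ?G i)) / len ?G i + len ?G i / 2 \<and>
        u1 i (len ?G i) = (q (Suc i) - q (src ?G i)) / len ?G i - len ?G i / 2 \<and>
        integral {0..len ?G i} (u i) = (q (src ?G i) + q (Suc i)) / 2 * len ?G i + len ?G i ^ 3 / 12"
      if i: "i < 15" for i
      using torsion_edge[OF len_G1_pos[OF pos i] H[OF i]] ae i q[OF i] by (simp add: edges_G1)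
    have q7: "q 7 = 0" "q 8 = 0" "q 9 = 0" "q 10 = 0" "q 11 = 0" "q 12 = 0" "q 13 = 0" "q 14 = 0" "q 15 = 0"
      using q0 by simp_all
    have "\<forall>i<15. u1 i 0 = (q (Suc i) - q (src ?G i)) / len ?G i + len ?G i / 2 \<and>
        u1 i (len ?G i) = (q (Suc i) - q (src ?G i)) / len ?G i - len ?G i / 2" using e by blast
    moreover have "u1 0 0 + u1 1 0 + u1 2 0 = 0 \<and>
        u1 3 0 + u1 6 0 = u1 0 (2 * c) \<and> u1 4 0 + u1 7 0 = u1 1 (2 * a) \<and>
        u1 5 0 + u1 8 0 = u1 2 (2 * b) \<and> u1 9 0 + u1 10 0 = u1 3 (2 * b) \<and>
        u1 11 0 + u1 12 0 = u1 4 (2 * c) \<and> u1 13 0 + u1 14 0 = u1 5 (2 * a)"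
      using D unfolding DSBC_G1_iff by blast
    ultimately have "torsion_values a b c q"
      unfolding all_less_15_iff torsion_values_def
      by (simp add: q7 numeral_2_eq_2[symmetric] diff_divide_distrib)
    moreover have "t = torsion_value a b c q"
    proof -
      have "t = (\<Sum>i<15. (q (src ?G i) + q (Suc i)) / 2 * len ?G i + len ?G i ^ 3 / 12)"
        unfolding t edges_G1 by (rule sum.cong) (use e in auto)
      then show ?thesis
        unfolding sum_less_15 torsion_value_def
        by (simp add: q7 field_simps flip: numeral_2_eq_2)
    qed
    ultimately show ?thesis using torsion_value_unique[OF p] by simp
  qed
  define r where "r v = (if v < 7 then p v else 0)" for v
  have "\<forall>i. \<exists>f f1. i < 15 \<longrightarrow> H2_edge (len ?G i) f f1 (\<lambda>_. -1) \<and> f 0 = r (src ?G i) \<and> f (len ?G i) = r (Suc i)"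
    using ex_torsion_edge len_G1_pos[OF pos] by meson
  then obtain u u1 where u: "\<And>i. i < 15 \<Longrightarrow> H2_edge (len ?G i) (u i) (u1 i) (\<lambda>_. -1) \<and>
      u i 0 = r (src ?G i) \<and> u i (len ?G i) = r (Suc i)"
    by metis
  have e: "u1 i 0 = (r (Suc i) - r (src ?G i)) / len ?G i + len ?G i / 2 \<and>
      u1 i (len ?G i) = (r (Suc i) - r (src ?G i)) / len ?G i - len ?G i / 2" if i: "i < 15" for i
    using torsion_edge(1,2)[OF len_G1_pos[OF pos i], of "u i" "u1 i" "\<lambda>_. -1"] u[OF i] by simp
  have "\<forall>i<15. u1 i 0 = (r (Suc i) - r (src ?G i)) / len ?G i + len ?G i / 2 \<and>
      u1 i (len ?G i) = (r (Suc i) - r (src ?G i)) / len ?G i - len ?G i / 2" using e by blast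
  then have K: "u1 0 0 + u1 1 0 + u1 2 0 = 0 \<and>
      u1 3 0 + u1 6 0 = u1 0 (2 * c) \<and> u1 4 0 + u1 7 0 = u1 1 (2 * a) \<and>
      u1 5 0 + u1 8 0 = u1 2 (2 * b) \<and> u1 9 0 + u1 10 0 = u1 3 (2 * b) \<and>
      u1 11 0 + u1 12 0 = u1 4 (2 * c) \<and> u1 13 0 + u1 14 0 = u1 5 (2 * a)"
    using p unfolding all_less_15_iff torsion_values_def
    by (simp add: r_def numeral_2_eq_2[symmetric] diff_divide_distrib)
  have DSBC: "DSBC ?G u u1 (\<lambda>_ _. -1)"
    unfolding DSBC_G1_iff
  proof (intro conjI exI[of _ r])
    show "\<forall>v\<in>{7..15}. r v = 0" by (simp add: r_def)
  qed (use u K in blast)+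
  have v: "(\<Sum>i\<in>edges ?G. integral {0..len ?G i} (u i)) = torsion_value a b c p"
    by (rule val[OF DSBC _ refl]) simp
  show ?thesis
    unfolding torsion_def
  proof (rule the_equality)
    show "\<exists>u u1 u2. DSBC ?G u u1 u2 \<and>
      (\<forall>i\<in>edges ?G. negligible {x \<in> {0..len ?G i}. u2 i x \<noteq> -1}) \<and>
      torsion_value a b c p = (\<Sum>i\<in>edges ?G. integral {0..len ?G i} (u i))"
      using DSBC v by (intro exI[of _ u] exI[of _ u1] exI[of _ "\<lambda>_ _. -1"]) simp
  qed (use val in blast)
qed

text \<open>Here and in the next two lemmas the numerators are arbitrary numbers, so that
  denominators are cleared without unfolding the large polynomials.\<close>

lemma vertex_equation_o:
  fixes a b c d :: real
  assumes "a > 0" "b > 0" "c > 0" "d > 0"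
    and "a * b * (x - o') + b * c * (y - o') + a * c * (z - o') + 2 * a * b * c * (a + b + c) * d = 0"
  shows "(x / d - o' / d) / (2*c) + c + (y / d - o' / d) / (2*a) + a + (z / d - o' / d) / (2*b) + b = 0"
proof -
  have "(x / d - o' / d) / (2*c) + c + (y / d - o' / d) / (2*a) + a + (z / d - o' / d) / (2*b) + b =
    (a * b * (x - o') + b * c * (y - o') + a * c * (z - o') + 2 * a * b * c * (a + b + c) * d) / (2*a*b*c*d)"
    using assms(1-4) by (simp add: field_simps)
  then show ?thesis using assms(5) by simp
qed

lemma vertex_equation_m:
  fixes a b c d :: real
  assumes "a > 0" "b > 0" "c > 0" "d > 0"
    and "a * b * (o' - m) + a * c * (w - m) - 2 * b * c * m + a * b * c * (2 * c + 2 * b + a) * d = 0"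
  shows "(o' / d - m / d) / (2*c) + c + (w / d - m / d) / (2*b) + b - m / d / a + a / 2 = 0"
proof -
  have "(o' / d - m / d) / (2*c) + c + (w / d - m / d) / (2*b) + b - m / d / a + a / 2 =
    (a * b * (o' - m) + a * c * (w - m) - 2 * b * c * m + a * b * c * (2 * c + 2 * b + a) * d) / (2*a*b*c*d)"
    using assms(1-4) by (simp add: field_simps)
  then show ?thesis using assms(5) by simp
qed

lemma vertex_equation_w:
  fixes a b c d :: real
  assumes "a > 0" "b > 0" "c > 0" "d > 0"
    and "a * c * (m - w) - 2 * b * c * w - 2 * a * b * w + a * b * c * (2 * b + a + c) * d = 0"
  shows "(m / d - w / d) / (2*b) + b - w / d / a + a / 2 - w / d / c + c / 2 = 0"
proof -
  have "(m / d - w / d) / (2*b) + b - w / d / a + a / 2 - w / d / c + c / 2 =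
    (a * c * (m - w) - 2 * b * c * w - 2 * a * b * w + a * b * c * (2 * b + a + c) * d) / (2*a*b*c*d)"
    using assms(1-4) by (simp add: field_simps)
  then show ?thesis using assms(5) by simp
qed

lemma torsion_G1_eq:
  assumes pos: "a > 0" "b > 0" "c > 0"
  shows "torsion (G1 a b c) = tors_num a b c / tors_den a b c / 2 + 19 * (a ^ 3 + b ^ 3 + c ^ 3) / 12"
proof -
  let ?d = "tors_den a b c"
  define p where "p v = [tors_o a b c, tors_m a b c, tors_m b c a, tors_m c a b,
    tors_w a b c, tors_w b c a, tors_w c a b] ! v / ?d" for v
  have d: "?d > 0" using tors_den_pos[OF pos] .
  have r: "tors_den b c a = ?d" "tors_den c a b = ?d" "tors_o b c a = tors_o a b c" "tors_o c a b = tors_o a b c"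
    using tors_den_rotate tors_o_rotate by metis+
  note m = vertex_equation_m[OF _ _ _ d tors_identity_m[of a b c]]
    vertex_equation_m[OF _ _ _ d tors_identity_m[of b c a, unfolded r]]
    vertex_equation_m[OF _ _ _ d tors_identity_m[of c a b, unfolded r]]
  note w = vertex_equation_w[OF _ _ _ d tors_identity_w[where a=a and b=b and c=c]]
    vertex_equation_w[OF _ _ _ d tors_identity_w[where a=b and b=c and c=a, unfolded r]]
    vertex_equation_w[OF _ _ _ d tors_identity_w[where a=c and b=a and c=b, unfolded r]]
  have p: "p 0 = tors_o a b c / ?d" "p 1 = tors_m a b c / ?d" "p 2 = tors_m b c a / ?d"
    "p 3 = tors_m c a b / ?d" "p 4 = tors_w a b c / ?d" "p 5 = tors_w b c a / ?d" "p 6 = tors_w c a b / ?d"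
    by (simp_all add: p_def)
  have "torsion_values a b c p"
    unfolding torsion_values_def p
    by (intro conjI vertex_equation_o[OF pos d tors_identity_o] m w pos)
  then have "torsion (G1 a b c) = torsion_value a b c p" by (rule torsion_G1[OF pos])
  then show ?thesis
    unfolding torsion_value_def p tors_num_def by (simp add: add_divide_distrib)
qed

lemma torsion_G1_neq:
  assumes pos: "a > 0" "b > 0" "c > 0" and "a \<noteq> b" "b \<noteq> c" "a \<noteq> c"
  shows "torsion (G1 a b c) \<noteq> torsion (G1 a c b)"
proof -
  have "a ^ 3 + c ^ 3 + b ^ 3 = a ^ 3 + b ^ 3 + c ^ 3" by simp
  then have "torsion (G1 a b c) - torsion (G1 a c b) = (tors_num a b c - tors_num a c b) / tors_den a b c / 2"
    unfolding torsion_G1_eq[OF pos] torsion_G1_eq[OF pos(1,3,2)] tors_den_swap[where a=a and b=b and c=c]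
    by (simp only: add_diff_cancel_right diff_divide_distrib)
  also have "\<dots> = (a - b) * (b - c) * (c - a) * tors_diff a b c / tors_den a b c"
    unfolding tors_num_diff by simp
  also have "\<dots> \<noteq> 0"
    using assms tors_den_pos[OF pos] tors_diff_pos[OF pos] by simp
  finally show ?thesis by simp
qed

section \<open>Distances in metric trees\<close>

text \<open>In a tree whose edge \<open>i\<close> leads from its parent end to the vertex \<open>Suc i\<close>, a point is described by one
  coordinate for each edge \<open>e\<close>: the length of the part of \<open>e\<close> on the way from the root to the point. This
  embeds the tree isometrically into \<open>l\<^sup>1\<close>.\<close>

inductive below :: "mgraph \<Rightarrow> nat \<Rightarrow> nat \<Rightarrow> bool" for G e where
  base: "below G e (Suc e)"
| step: "i < length G \<Longrightarrow> below G e (src G i) \<Longrightarrow> below G e (Suc i)"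

definition vcoord :: "mgraph \<Rightarrow> nat \<Rightarrow> nat \<Rightarrow> real" where
  "vcoord G e v = (if below G e v then len G e else 0)"

definition coord :: "mgraph \<Rightarrow> nat \<Rightarrow> nat \<times> real \<Rightarrow> real" where
  "coord G e p = (if e = fst p then snd p else vcoord G e (src G (fst p)))"

definition vertex_dist :: "mgraph \<Rightarrow> nat \<Rightarrow> nat \<Rightarrow> real" where
  "vertex_dist G u v = (\<Sum>e<length G. \<bar>vcoord G e u - vcoord G e v\<bar>)"

definition point_dist :: "mgraph \<Rightarrow> nat \<times> real \<Rightarrow> nat \<times> real \<Rightarrow> real" where
  "point_dist G p q = (\<Sum>e<length G. \<bar>coord G e p - coord G e q\<bar>)"

text \<open>Distance 0 takes the place of equality, since a vertex is represented by one point on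
  each edge that meets it.\<close>

definition end_point :: "mgraph \<Rightarrow> nat \<times> real \<Rightarrow> bool" where
  "end_point G p \<longleftrightarrow> p \<in> points G \<and> (\<forall>y\<in>points G. \<forall>z\<in>points G.
     pdist G y z = pdist G y p + pdist G p z \<longrightarrow> pdist G y p = 0 \<or> pdist G p z = 0)"

lemma is_walk_append: "is_walk G u v ws \<Longrightarrow> is_walk G v w ws' \<Longrightarrow> is_walk G u w (ws @ ws')"
  by (induction G u v ws rule: is_walk.induct) auto

lemma vertex_dist_commute: "vertex_dist G u v = vertex_dist G v u"
  by (simp add: vertex_dist_def abs_minus_commute)

lemma vertex_dist_self: "vertex_dist G v v = 0"
  by (simp add: vertex_dist_def)

lemma vertex_dist_triangle: "vertex_dist G u w \<le> vertex_dist G u v + vertex_dist G v w"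
  unfolding vertex_dist_def sum.distrib[symmetric] by (intro sum_mono) linarith

lemma point_dist_commute: "point_dist G p q = point_dist G q p"
  by (simp add: point_dist_def abs_minus_commute)

lemma point_dist_triangle: "point_dist G p r \<le> point_dist G p q + point_dist G q r"
  unfolding point_dist_def sum.distrib[symmetric] by (intro sum_mono) linarith

locale rooted_tree =
  fixes G :: mgraph
  assumes tgt_eq: "\<And>i. i < length G \<Longrightarrow> tgt G i = Suc i"
    and src_le: "\<And>i. i < length G \<Longrightarrow> src G i \<le> i"
    and len_pos: "\<And>i. i < length G \<Longrightarrow> len G i > 0"
begin

lemma below_imp_less: "below G e v \<Longrightarrow> e < v"
  by (induction rule: below.induct) (auto dest: src_le)

lemma below_Suc: "i < length G \<Longrightarrow> e \<noteq> i \<Longrightarrow> below G e (Suc i) \<longleftrightarrow> below G e (src G i)"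
  by (auto intro: below.step elim: below.cases)

lemma vcoord_Suc: "i < length G \<Longrightarrow> e \<noteq> i \<Longrightarrow> vcoord G e (Suc i) = vcoord G e (src G i)"
  by (simp add: vcoord_def below_Suc)

lemma vcoord_Suc_self: "vcoord G e (Suc e) = len G e"
  by (simp add: vcoord_def below.base)

lemma vcoord_eq_0: "v \<le> e \<Longrightarrow> vcoord G e v = 0"
  using below_imp_less by (fastforce simp: vcoord_def)

text \<open>Moving from \<open>Suc i\<close> to its parent changes only coordinate \<open>i\<close>,
  from full length to 0, and a vertex numbered at most \<open>i\<close> has 0 there.\<close>

lemma vertex_dist_Suc:
  assumes i: "i < length G" and v: "v \<le> i"
  shows "vertex_dist G (Suc i) v = len G i + vertex_dist G (src G i) v"
proof -
  have "\<bar>vcoord G e (Suc i) - vcoord G e v\<bar> =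
      (if e = i then len G i else 0) + \<bar>vcoord G e (src G i) - vcoord G e v\<bar>" for e
    using vcoord_Suc[OF i, of e] vcoord_eq_0[OF v] vcoord_eq_0[OF src_le[OF i]] len_pos[OF i]
    by (auto simp: vcoord_Suc_self)
  then show ?thesis using i by (simp add: vertex_dist_def sum.distrib)
qed

lemma walk_length_ge:
  "is_walk G u v ws \<Longrightarrow> vertex_dist G u v \<le> sum_list (map (len G) ws)"
proof (induction ws arbitrary: u)
  case Nil
  then show ?case by (simp add: vertex_dist_self)
next
  case (Cons i ws)
  from Cons.prems have i: "i < length G" by (simp add: edges_def)
  have e: "vertex_dist G (Suc i) (src G i) = len G i"
    using vertex_dist_Suc[OF i src_le[OF i]] by (simp add: vertex_dist_self)
  from Cons.prems tgt_eq[OF i] consider "src G i = u" "is_walk G (Suc i) v ws"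
    | "Suc i = u" "is_walk G (src G i) v ws" by auto
  then show ?case
  proof cases
    case 1
    then show ?thesis
      using Cons.IH[OF 1(2)] vertex_dist_triangle[of G u v "Suc i"] e vertex_dist_commute[of G u "Suc i"]
      by simp
  next
    case 2
    then show ?thesis
      using Cons.IH[OF 2(2)] vertex_dist_triangle[of G u v "src G i"] e by simp
  qed
qed

lemma ex_walk:
  "u \<le> length G \<Longrightarrow> v \<le> length G \<Longrightarrow>
    \<exists>ws. is_walk G u v ws \<and> sum_list (map (len G) ws) = vertex_dist G u v"
proof (induction "u + v" arbitrary: u v rule: less_induct)
  case less
  consider "u = v" | "u > v" | "v > u" by linarith
  then show ?case
  proof cases
    case 1
    then show ?thesis by (intro exI[of _ "[]"]) (simp add: vertex_dist_self)
  next
    case 2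
    then obtain i where u: "u = Suc i" by (cases u) auto
    with less.prems 2 have i: "i < length G" "v \<le> i" by auto
    have "src G i + v < u + v" "src G i \<le> length G" using src_le[OF i(1)] u i(1) by auto
    from less.hyps[OF this less.prems(2)] obtain ws
      where "is_walk G (src G i) v ws" "sum_list (map (len G) ws) = vertex_dist G (src G i) v" by blast
    then show ?thesis
      using i tgt_eq[OF i(1)] by (intro exI[of _ "i # ws"]) (simp add: u vertex_dist_Suc edges_def)
  next
    case 3
    then obtain i where v: "v = Suc i" by (cases v) auto
    with less.prems 3 have i: "i < length G" "u \<le> i" by auto
    have "u + src G i < u + v" "src G i \<le> length G" using src_le[OF i(1)] v i(1) by auto
    from less.hyps[OF this(1) less.prems(1) this(2)] obtain ws
      where ws: "is_walk G u (src G i) ws" "sum_list (map (len G) ws) = vertex_dist G u (src G i)" by blast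
    have "is_walk G u v (ws @ [i])"
      by (rule is_walk_append[OF ws(1)]) (use i tgt_eq[OF i(1)] in \<open>simp add: v edges_def\<close>)
    moreover have "sum_list (map (len G) (ws @ [i])) = vertex_dist G u v"
      using ws(2) vertex_dist_Suc[OF i] by (simp add: v vertex_dist_commute)
    ultimately show ?thesis by blast
  qed
qed

lemma vdist_eq:
  assumes "u \<le> length G" "v \<le> length G"
  shows "vdist G u v = vertex_dist G u v"
  unfolding vdist_def
proof (rule cInf_eq_minimum)
  show "vertex_dist G u v \<in> {sum_list (map (len G) ws) | ws. is_walk G u v ws}"
    using ex_walk[OF assms] by (auto, metis)
qed (auto dest: walk_length_ge)

lemma dist_to_end:
  assumes i: "i < length G" and x: "0 \<le> x" "x \<le> len G i" and a: "(a, d) \<in> ends G i x"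
  shows "a \<le> length G" and "(\<Sum>e<length G. \<bar>coord G e (i, x) - vcoord G e a\<bar>) = d"
    and "\<And>e. e \<noteq> i \<Longrightarrow> vcoord G e a = vcoord G e (src G i)"
proof -
  from a tgt_eq[OF i] consider "a = src G i" "d = x" | "a = Suc i" "d = len G i - x"
    by (auto simp: ends_def)
  then have "a \<le> length G \<and> (\<forall>e. \<bar>coord G e (i, x) - vcoord G e a\<bar> = (if e = i then d else 0)) \<and>
      (\<forall>e. e \<noteq> i \<longrightarrow> vcoord G e a = vcoord G e (src G i))"
  proof cases
    case 1
    then show ?thesis using i x src_le[OF i] by (auto simp: coord_def vcoord_eq_0)
  next
    case 2
    then show ?thesis using i x by (auto simp: coord_def vcoord_Suc_self vcoord_Suc)
  qed
  then show "a \<le> length G" "(\<Sum>e<length G. \<bar>coord G e (i, x) - vcoord G e a\<bar>) = d"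
    "\<And>e. e \<noteq> i \<Longrightarrow> vcoord G e a = vcoord G e (src G i)" using i by simp_all
qed

lemma ex_end:
  assumes i: "i < length G"
  shows "\<exists>a d. (a, d) \<in> ends G i x \<and> vcoord G i a = vcoord G i v"
proof (cases "below G i v")
  case True
  then have "vcoord G i v = vcoord G i (Suc i)" by (simp add: vcoord_def below.base)
  then show ?thesis using tgt_eq[OF i] by (auto simp: ends_def)
next
  case False
  then have "vcoord G i v = vcoord G i (src G i)" using vcoord_eq_0[OF src_le[OF i]] by (simp add: vcoord_def)
  then show ?thesis by (auto simp: ends_def)
qed

text \<open>The triangle inequality in each coordinate bounds every route from below. For points on
  different edges equality holds when each edge is left through the end that faces the other edge,
  which is the choice made by \<open>ex_end\<close>.\<close>

lemma pdist_eq: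
  assumes p: "p \<in> points G" and q: "q \<in> points G"
  shows "pdist G p q = point_dist G p q"
proof -
  obtain i x where px: "p = (i, x)" by fastforce
  obtain j y where qy: "q = (j, y)" by fastforce
  have i: "i < length G" "0 \<le> x" "x \<le> len G i" using p by (auto simp: px points_def edges_def)
  have j: "j < length G" "0 \<le> y" "y \<le> len G j" using q by (auto simp: qy points_def edges_def)
  have same: "point_dist G p q = \<bar>x - y\<bar>" if "i = j"
  proof -
    have "\<bar>coord G e p - coord G e q\<bar> = (if e = i then \<bar>x - y\<bar> else 0)" for e
      using that by (simp add: coord_def px qy)
    then show ?thesis using i by (simp add: point_dist_def)
  qed
  have lower: "point_dist G p q \<le> dA + vdist G a b + dB"
    if "(a, dA) \<in> ends G i x" "(b, dB) \<in> ends G j y" for a b dA dB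
  proof -
    note A = dist_to_end[OF i that(1)] and B = dist_to_end[OF j that(2)]
    show ?thesis
      unfolding vdist_eq[OF A(1) B(1)] A(2)[symmetric] B(2)[symmetric]
      unfolding point_dist_def vertex_dist_def sum.distrib[symmetric] px qy
      by (intro sum_mono) linarith
  qed
  have attained: "\<exists>a b dA dB. (a, dA) \<in> ends G i x \<and> (b, dB) \<in> ends G j y \<and>
      point_dist G p q = dA + vdist G a b + dB" if ne: "i \<noteq> j"
  proof -
    obtain a dA where a: "(a, dA) \<in> ends G i x" "vcoord G i a = vcoord G i (src G j)"
      using ex_end[OF i(1)] by blast
    obtain b dB where b: "(b, dB) \<in> ends G j y" "vcoord G j b = vcoord G j (src G i)"
      using ex_end[OF j(1)] by blast
    note A = dist_to_end[OF i a(1)] and B = dist_to_end[OF j b(1)]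
    have "\<bar>coord G e p - coord G e q\<bar> = \<bar>coord G e (i, x) - vcoord G e a\<bar>
        + \<bar>vcoord G e a - vcoord G e b\<bar> + \<bar>coord G e (j, y) - vcoord G e b\<bar>" for e
      using ne a(2) b(2) A(3)[of e] B(3)[of e]
      by (cases "e = i"; cases "e = j") (simp_all add: coord_def px qy abs_minus_commute)
    then have "point_dist G p q = dA + vdist G a b + dB"
      unfolding vdist_eq[OF A(1) B(1)] A(2)[symmetric] B(2)[symmetric]
      by (simp add: point_dist_def vertex_dist_def sum.distrib)
    then show ?thesis using a(1) b(1) by blast
  qed
  show ?thesis
    unfolding pdist_def px qy prod.case
  proof (rule cInf_eq_minimum)
    show "point_dist G (i, x) (j, y) \<in> {\<bar>x - y\<bar> | _::unit. i = j} \<union>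
      {dA + vdist G a b + dB | a b dA dB. (a, dA) \<in> ends G i x \<and> (b, dB) \<in> ends G j y}"
      using same attained unfolding px qy by (cases "i = j") blast+
    fix t assume "t \<in> {\<bar>x - y\<bar> | _::unit. i = j} \<union>
      {dA + vdist G a b + dB | a b dA dB. (a, dA) \<in> ends G i x \<and> (b, dB) \<in> ends G j y}"
    then show "point_dist G (i, x) (j, y) \<le> t"
      using same lower unfolding px qy by auto
  qed
qed

lemma point_dist_leaf:
  assumes i: "i < length G" and j: "j < length G"
  shows "point_dist G (i, len G i) (j, len G j) = vertex_dist G (Suc i) (Suc j)"
proof -
  have "coord G e (i, len G i) = vcoord G e (Suc i)" if "i < length G" for e i
    using that by (simp add: coord_def vcoord_Suc vcoord_Suc_self)
  then show ?thesis using i j by (simp add: point_dist_def vertex_dist_def)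
qed

text \<open>Equality in the l1 triangle inequality forces equality in each coordinate. Coordinate
  \<open>i\<close> attains its maximum only at the leaf, so a leaf between two points must be one of
  them.\<close>

lemma leaf_end_point:
  assumes i: "i < length G" and leaf: "\<And>j. j < length G \<Longrightarrow> src G j \<noteq> Suc i"
  shows "end_point G (i, len G i)"
proof -
  let ?p = "(i, len G i)"
  have p: "?p \<in> points G" using i len_pos[OF i] by (simp add: points_def edges_def)
  have b: "v = Suc i" if "below G i v" for v
    using that by (induction rule: below.induct) (use leaf in auto)
  have c: "coord G i y \<le> len G i \<and> (coord G i y = len G i \<longrightarrow> y = ?p)" if "y \<in> points G" for y
  proof (cases "fst y = i")
    case True
    then show ?thesis using that by (cases y) (auto simp: coord_def points_def)
  next
    case False
    have "fst y < length G" using that by (auto simp: points_def edges_def)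
    then have "\<not> below G i (src G (fst y))" using b leaf by blast
    then show ?thesis using False len_pos[OF i] by (simp add: coord_def vcoord_def)
  qed
  have "point_dist G y ?p = 0 \<or> point_dist G ?p z = 0"
    if y: "y \<in> points G" and z: "z \<in> points G"
      and eq: "point_dist G y z = point_dist G y ?p + point_dist G ?p z" for y z
  proof -
    let ?g = "\<lambda>e. \<bar>coord G e y - coord G e ?p\<bar> + \<bar>coord G e ?p - coord G e z\<bar> - \<bar>coord G e y - coord G e z\<bar>"
    have "sum ?g {..<length G} = 0"
      using eq by (simp add: point_dist_def sum.distrib sum_subtractf)
    then have "?g i = 0"
      using i by (subst (asm) sum_nonneg_eq_0_iff) auto
    moreover have "coord G i ?p = len G i" by (simp add: coord_def)
    ultimately have "coord G i y = len G i \<or> coord G i z = len G i"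
      using c[OF y] c[OF z] by linarith
    then have "y = ?p \<or> z = ?p" using c y z by blast
    then show ?thesis by (auto simp: point_dist_def)
  qed
  then show ?thesis
    unfolding end_point_def using p by (auto simp: pdist_eq)
qed

text \<open>Every other point lies strictly between two explicit points: an inner point of an edge
  between the ends of the edge, a branching vertex between its parent and a child, and the root
  between two of its children, which the assumption \<open>root\<close> provides.\<close>

lemma end_point_imp_leaf:
  assumes root: "\<And>i. i < length G \<Longrightarrow> src G i = 0 \<Longrightarrow> \<exists>j<length G. j \<noteq> i \<and> src G j = 0"
    and p: "end_point G p"
  obtains i where "i < length G" and "\<And>j. j < length G \<Longrightarrow> src G j \<noteq> Suc i" and "p = (i, len G i)"
proof -
  obtain i x where px: "p = (i, x)" by fastforce
  have pp: "p \<in> points G" using p by (simp add: end_point_def)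
  then have i: "i < length G" "0 \<le> x" "x \<le> len G i" by (auto simp: px points_def edges_def)
  have no: False if y: "y \<in> points G" and z: "z \<in> points G"
      and between: "\<And>e. e < length G \<Longrightarrow> \<bar>coord G e y - coord G e z\<bar> =
        \<bar>coord G e y - coord G e p\<bar> + \<bar>coord G e p - coord G e z\<bar>"
      and e: "e < length G" "coord G e y \<noteq> coord G e p"
      and e': "e' < length G" "coord G e' p \<noteq> coord G e' z" for y z e e'
  proof -
    have "point_dist G y z = point_dist G y p + point_dist G p z"
      using between by (simp add: point_dist_def sum.distrib)
    with p y z pp have "point_dist G y p = 0 \<or> point_dist G p z = 0"
      unfolding end_point_def by (simp add: pdist_eq)
    then show False
      unfolding point_dist_def using e e' by (subst (asm) (1 2) sum_nonneg_eq_0_iff) auto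
  qed
  have pts: "(j, 0) \<in> points G" "(j, len G j) \<in> points G" if "j < length G" for j
    using that len_pos[OF that] by (simp_all add: points_def edges_def)
  have chain: False if k: "k < length G" and j: "j < length G" and kj: "src G j = Suc k"
      and pc: "\<And>e. coord G e p = vcoord G e (Suc k)" for k j
  proof -
    have "k < j" using src_le[OF j] kj by simp
    show False
    proof (rule no[OF pts(1)[OF k] pts(2)[OF j]])
      show "\<bar>coord G e (k, 0) - coord G e (j, len G j)\<bar> =
          \<bar>coord G e (k, 0) - coord G e p\<bar> + \<bar>coord G e p - coord G e (j, len G j)\<bar>" for e
      proof -
        have "coord G e (k, 0) = (if e = k then 0 else vcoord G e (src G k))"
          "coord G e (j, len G j) = (if e = j then len G j else vcoord G e (Suc k))"
          by (simp_all add: coord_def kj)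
        then show ?thesis
          using \<open>k < j\<close> vcoord_eq_0[of "Suc k" j] vcoord_eq_0[of "src G k" j] src_le[OF k]
          by (cases "e = k"; cases "e = j") (simp_all add: pc vcoord_Suc_self vcoord_Suc[OF k])
      qed
      show "coord G k (k, 0) \<noteq> coord G k p" using len_pos[OF k] unfolding pc by (simp add: coord_def vcoord_Suc_self)
      show "coord G j p \<noteq> coord G j (j, len G j)"
        using len_pos[OF j] \<open>k < j\<close> unfolding pc by (simp add: coord_def vcoord_eq_0)
    qed (fact k j)+
  qed
  have "x > 0"
  proof (rule ccontr)
    assume "\<not> x > 0"
    then have x: "x = 0" using i by simp
    have pc: "coord G e p = vcoord G e (src G i)" for e
      using src_le[OF i(1)] by (simp add: coord_def px x vcoord_eq_0)
    show False
    proof (cases "src G i")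
      case (Suc k)
      then show False using chain[of k i] pc i(1) src_le[OF i(1)] by simp
    next
      case 0
      from root[OF i(1) this] obtain j where j: "j < length G" "j \<noteq> i" "src G j = 0" by blast
      show False
      proof (rule no[OF pts(2)[OF i(1)] pts(2)[OF j(1)]])
        show "\<bar>coord G e (i, len G i) - coord G e (j, len G j)\<bar> =
            \<bar>coord G e (i, len G i) - coord G e p\<bar> + \<bar>coord G e p - coord G e (j, len G j)\<bar>" for e
          using j by (simp add: coord_def px x 0 vcoord_eq_0)
        show "coord G i (i, len G i) \<noteq> coord G i p" "coord G j p \<noteq> coord G j (j, len G j)"
          using len_pos[OF i(1)] len_pos[OF j(1)] j by (simp_all add: coord_def px x 0 vcoord_eq_0)
      qed (fact i j)+
    qed
  qed
  moreover have "x \<ge> len G i"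
  proof (rule ccontr)
    assume "\<not> x \<ge> len G i"
    show False
    proof (rule no[OF pts[OF i(1)]])
      show "\<bar>coord G e (i, 0) - coord G e (i, len G i)\<bar> =
          \<bar>coord G e (i, 0) - coord G e p\<bar> + \<bar>coord G e p - coord G e (i, len G i)\<bar>" for e
        using i by (simp add: coord_def px)
      show "coord G i (i, 0) \<noteq> coord G i p" "coord G i p \<noteq> coord G i (i, len G i)"
        using \<open>x > 0\<close> \<open>\<not> x \<ge> len G i\<close> by (simp_all add: coord_def px)
    qed (fact i)+
  qed
  ultimately have x: "x = len G i" using i by simp
  have "src G j \<noteq> Suc i" if "j < length G" for j
    using chain[OF i(1) that] by (metis coord_def fst_conv snd_conv px x i(1) vcoord_Suc vcoord_Suc_self)
  then show ?thesis using that[OF i(1)] px x by blast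
qed

end

section \<open>Ends under isometries, and their distances in \<open>G1\<close>\<close>

lemma isometry_end_point:
  assumes G: "rooted_tree G" and H: "rooted_tree H"
    and f: "\<And>p. p \<in> points G \<Longrightarrow> f p \<in> points H"
    and iso: "\<And>p q. p \<in> points G \<Longrightarrow> q \<in> points G \<Longrightarrow> pdist H (f p) (f q) = pdist G p q"
    and onto: "\<And>q. q \<in> points H \<Longrightarrow> \<exists>p\<in>points G. pdist H (f p) q = 0"
    and p: "end_point G p"
  shows "end_point H (f p)"
  unfolding end_point_def
proof (intro conjI ballI impI)
  interpret H: rooted_tree H by fact
  have pG: "p \<in> points G" using p by (simp add: end_point_def)
  then show fp: "f p \<in> points H" by (rule f)
  fix y z assume y: "y \<in> points H" and z: "z \<in> points H"
    and eq: "pdist H y z = pdist H y (f p) + pdist H (f p) z"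
  from onto[OF y] obtain y' where y': "y' \<in> points G" "pdist H (f y') y = 0" by blast
  from onto[OF z] obtain z' where z': "z' \<in> points G" "pdist H (f z') z = 0" by blast
  \<comment> \<open>An isometry is onto only up to distance 0, so \<open>y\<close> and
    \<open>z\<close> are replaced by nearby images, which changes no distance.\<close>
  have same: "pdist H q r = pdist H q' r"
    if "q \<in> points H" "q' \<in> points H" "r \<in> points H" "pdist H q' q = 0" for q q' r
    using that point_dist_triangle[of H q r q'] point_dist_triangle[of H q' r q]
      point_dist_commute[of H q q'] by (simp add: H.pdist_eq)
  have comm: "pdist H q r = pdist H r q" if "q \<in> points H" "r \<in> points H" for q r
    using that by (simp add: H.pdist_eq point_dist_commute)
  have fy: "f y' \<in> points H" and fz: "f z' \<in> points H" using y' z' f by blast+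
  have 1: "pdist H y (f p) = pdist G y' p"
    using same[OF y fy fp y'(2)] iso[OF y'(1) pG] by simp
  have 2: "pdist H (f p) z = pdist G p z'"
    using same[OF z fz fp z'(2)] iso[OF pG z'(1)] comm fp fz z by simp
  have "pdist H y z = pdist H (f y') (f z')"
    using same[OF y fy z y'(2)] same[OF z fz fy z'(2)] comm fy fz z by simp
  then have 3: "pdist H y z = pdist G y' z'" using iso y' z' by simp
  show "pdist H y (f p) = 0 \<or> pdist H (f p) z = 0"
    using p y'(1) z'(1) eq unfolding end_point_def 1 2 3 by blast
qed

lemma rooted_tree_G1:
  assumes "a > 0" "b > 0" "c > 0"
  shows "rooted_tree (G1 a b c)"
proof
  have l: "length (G1 a b c) = 15" by (simp add: G1_def)
  fix i assume "i < length (G1 a b c)"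
  then have i: "i < 15" using l by simp
  show "tgt (G1 a b c) i = Suc i" "src (G1 a b c) i \<le> i"
    using i src_G1_le by simp_all
  show "len (G1 a b c) i > 0" using len_G1_pos[OF assms i] .
qed

lemma end_point_G1_iff:
  assumes "a > 0" "b > 0" "c > 0"
  shows "end_point (G1 a b c) p \<longleftrightarrow> p \<in> (\<lambda>i. (i, len (G1 a b c) i)) ` {6..<15}"
proof -
  let ?G = "G1 a b c"
  interpret rooted_tree ?G using assms by (rule rooted_tree_G1)
  have l: "length ?G = 15" by (simp add: G1_def)
  have leaf: "(\<forall>j<15. src ?G j \<noteq> Suc i) \<longleftrightarrow> i \<ge> 6" for i
    unfolding all_less_15_iff by (simp, linarith)
  have root: "\<exists>j<length ?G. j \<noteq> i \<and> src ?G j = 0" for i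
    unfolding l by (rule exI[of _ "if i = 0 then 1 else 0"]) simp
  show ?thesis
  proof
    assume "end_point ?G p"
    from end_point_imp_leaf[OF root this] obtain i where "i < 15" "\<forall>j<15. src ?G j \<noteq> Suc i" "p = (i, len ?G i)"
      unfolding l by metis
    then show "p \<in> (\<lambda>i. (i, len ?G i)) ` {6..<15}" unfolding leaf by auto
  next
    assume "p \<in> (\<lambda>i. (i, len ?G i)) ` {6..<15}"
    then obtain i where i: "i \<ge> 6" "i < 15" and p: "p = (i, len ?G i)" by auto
    show "end_point ?G p"
      unfolding p by (rule leaf_end_point) (use i leaf[of i] l in auto)
  qed
qed

text \<open>The sums of the first and second powers of the distances between the ends agree on the two graphs:
  the difference is an alternating polynomial in \<open>a\<close>, \<open>b\<close>, \<open>c\<close>, hence divisible by the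
  Vandermonde product. So the cubes are the first power that can tell the graphs apart.\<close>

definition leaf_cube_sum :: "mgraph \<Rightarrow> real" where
  "leaf_cube_sum G = (\<Sum>i\<in>{6..<15}. \<Sum>j\<in>{6..<15}. vertex_dist G (Suc i) (Suc j) ^ 3)"

text \<open>As rewrite rules for both orders of the arguments, these always replace the larger
  vertex by its parent, so simplification computes each distance and terminates.\<close>

lemma vertex_dist_G1:
  assumes pos: "a > 0" "b > 0" "c > 0" and u: "v < u" "u < 16"
  shows "vertex_dist (G1 a b c) u v =
      len (G1 a b c) (u - 1) + vertex_dist (G1 a b c) (src (G1 a b c) (u - 1)) v"
    and "vertex_dist (G1 a b c) v u =
      len (G1 a b c) (u - 1) + vertex_dist (G1 a b c) (src (G1 a b c) (u - 1)) v"
proof -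
  interpret rooted_tree "G1 a b c" using pos by (rule rooted_tree_G1)
  have "u - 1 < length (G1 a b c)" "v \<le> u - 1" "Suc (u - 1) = u" using u by (simp_all add: G1_def)
  from vertex_dist_Suc[OF this(1,2)] this(3)
  show "vertex_dist (G1 a b c) u v =
      len (G1 a b c) (u - 1) + vertex_dist (G1 a b c) (src (G1 a b c) (u - 1)) v" by simp
  then show "vertex_dist (G1 a b c) v u =
      len (G1 a b c) (u - 1) + vertex_dist (G1 a b c) (src (G1 a b c) (u - 1)) v"
    by (simp only: vertex_dist_commute[of _ v u])
qed

lemma leaf_cube_sum_diff:
  assumes pos: "a > 0" "b > 0" "c > 0"
  shows "leaf_cube_sum (G1 a b c) - leaf_cube_sum (G1 a c b) = -24 * ((a - b) * (b - c) * (c - a))"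
proof -
  have s: "{6..<15} = {6, 7, 8, 9, 10, 11, 12, 13, 14::nat}" by auto
  show ?thesis
    unfolding leaf_cube_sum_def s
    by (simp add: vertex_dist_G1 vertex_dist_self pos) algebra
qed

lemma not_isometric_G1:
  assumes pos: "a > 0" "b > 0" "c > 0" and ne: "a \<noteq> b" "b \<noteq> c" "a \<noteq> c"
  shows "\<not> isometric (G1 a b c) (G1 a c b)"
proof
  let ?G = "G1 a b c" and ?H = "G1 a c b"
  assume "isometric ?G ?H"
  then obtain f where f: "\<And>p. p \<in> points ?G \<Longrightarrow> f p \<in> points ?H"
      and iso: "\<And>p q. p \<in> points ?G \<Longrightarrow> q \<in> points ?G \<Longrightarrow> pdist ?H (f p) (f q) = pdist ?G p q"
      and onto: "\<And>q. q \<in> points ?H \<Longrightarrow> \<exists>p\<in>points ?G. pdist ?H (f p) q = 0"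
    unfolding isometric_def by metis
  interpret G: rooted_tree ?G using pos by (rule rooted_tree_G1)
  interpret H: rooted_tree ?H using pos by (intro rooted_tree_G1)
  define leaf where "leaf K i = (i, len K i)" for K i
  let ?L = "leaf ?G ` {6..<15}" and ?M = "leaf ?H ` {6..<15}"
  have L: "end_point ?G p \<longleftrightarrow> p \<in> ?L" and M: "end_point ?H p \<longleftrightarrow> p \<in> ?M" for p
    using end_point_G1_iff[OF pos] end_point_G1_iff[OF pos(1,3,2)] by (simp_all add: leaf_def[abs_def])
  have LG: "?L \<subseteq> points ?G" using L by (metis end_point_def subsetI)
  have inj: "inj_on (leaf K) {6..<15}" for K by (simp add: leaf_def inj_on_def)
  have dist: "point_dist K (leaf K i) (leaf K j) = vertex_dist K (Suc i) (Suc j)"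
    if "K = ?G \<or> K = ?H" "i \<in> {6..<15}" "j \<in> {6..<15}" for K i j
    using that G.point_dist_leaf[of i j] H.point_dist_leaf[of i j] by (auto simp: leaf_def G1_def)
  have "inj_on f ?L"
  proof (rule inj_onI)
    fix p q assume p: "p \<in> ?L" and q: "q \<in> ?L" and eq: "f p = f q"
    have pq: "p \<in> points ?G" "q \<in> points ?G" using p q LG by blast+
    have "point_dist ?G p q = point_dist ?H (f p) (f q)"
      using iso[OF pq] G.pdist_eq[OF pq] H.pdist_eq[OF f[OF pq(1)] f[OF pq(2)]] by simp
    then have 0: "point_dist ?G p q = 0" using eq by (simp add: point_dist_def)
    \<comment> \<open>Coordinate \<open>i\<close> separates two different ends: it is the full
      length of edge \<open>i\<close> at the first and 0 at the second.\<close>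
    obtain i j where ij: "p = leaf ?G i" "q = leaf ?G j" "i \<in> {6..<15}" "j \<in> {6..<15}" using p q by blast
    have "\<bar>coord ?G i p - coord ?G i q\<bar> = 0"
      using 0 ij(3) unfolding point_dist_def by (subst (asm) sum_nonneg_eq_0_iff) (auto simp: G1_def)
    moreover have "\<not> below ?G i (src ?G j)"
      using G.below_imp_less[of i "src ?G j"] src_G1_less_7[of j a b c] ij by auto
    ultimately show "p = q"
      using ij G.len_pos[of i] by (cases "i = j") (auto simp: coord_def leaf_def vcoord_def G1_def)
  qed
  moreover have "f ` ?L \<subseteq> ?M"
    using isometry_end_point[OF G.rooted_tree_axioms H.rooted_tree_axioms f iso onto] L M by blast
  moreover have "card ?L = card ?M" by (simp add: card_image inj)
  ultimately have bij: "bij_betw f ?L ?M"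
    unfolding bij_betw_def by (metis card_image card_subset_eq finite_atLeastLessThan finite_imageI)
  have sum: "leaf_cube_sum K = (\<Sum>p\<in>leaf K ` {6..<15}. \<Sum>q\<in>leaf K ` {6..<15}. point_dist K p q ^ 3)"
    if "K = ?G \<or> K = ?H" for K
    unfolding leaf_cube_sum_def sum.reindex[OF inj] comp_def
    by (intro sum.cong refl) (simp only: dist[OF that])
  have "leaf_cube_sum ?H = (\<Sum>p\<in>?L. \<Sum>q\<in>?L. point_dist ?H (f p) (f q) ^ 3)"
    unfolding sum[OF disjI2[OF refl]] sum.reindex_bij_betw[OF bij, symmetric] ..
  also have "\<dots> = (\<Sum>p\<in>?L. \<Sum>q\<in>?L. point_dist ?G p q ^ 3)"
  proof (intro sum.cong refl)
    fix p q assume "p \<in> ?L" "q \<in> ?L"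
    then have "p \<in> points ?G" "q \<in> points ?G" using LG by blast+
    then show "point_dist ?H (f p) (f q) ^ 3 = point_dist ?G p q ^ 3"
      using iso f by (simp add: G.pdist_eq H.pdist_eq)
  qed
  also have "\<dots> = leaf_cube_sum ?G" using sum by simp
  finally have "(a - b) * (b - c) * (c - a) = 0" using leaf_cube_sum_diff[OF pos] by simp
  then show False using ne by simp
qed

theorem theorem1:
  fixes a b c :: real
  assumes "a > 0" and "b > 0" and "c > 0"
    and "a \<noteq> b" and "b \<noteq> c" and "a \<noteq> c"
  shows "isospectral (G1 a b c) (G2 a b c) \<and> \<not> isometric (G1 a b c) (G2 a b c)
         \<and> torsion (G1 a b c) \<noteq> torsion (G2 a b c)"
  unfolding G2_eq
  by (intro conjI isospectral_G1 not_isometric_G1 torsion_G1_neq assms)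

end
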